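(* Let $\nu>-1$. Then for every integer $n\ge1$, $$\sum_{k \ge 1} \frac{1}{\Big[ \big(j_n^{\nu}\big)^2 - \big(j_k^{\nu+2} \big)^2 \Big]^2} = \frac{1}{16 (\nu+1)^2} - \frac{\nu+2}{\big(j_n^{\nu}\big)^4}.$$
   Context: For $\mu>-1$, $\{j_n^{\mu}: n\ge1\}$ denotes the sequence of strictly positive zeros, in ascending order, of the Bessel function of the first kind $J_\mu$. *)

theory Defs
  imports "HOL-Analysis.Analysis"
begin

text \<open>
  Bessel function of the first kind of real order \<open>\<mu>\<close>, by its ascending series. Because of
  \<open>powr\<close>, this is meaningful only for arguments \<open>x > 0\<close>, which suffices for positive zeros.
  Where the Gamma function has a pole, the library's \<open>Gamma\<close> is \<open>0\<close> and so is the term, in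
  agreement with the usual convention \<open>1 / \<Gamma> = 0\<close> there.
\<close>

definition bessel_J :: "real \<Rightarrow> real \<Rightarrow> real" where
  "bessel_J \<mu> x =
     (\<Sum>m. (- 1) ^ m / (fact m * Gamma (real m + \<mu> + 1)) * (x / 2) powr (2 * real m + \<mu>))"

text \<open>
  \<open>bessel_zero \<mu> n\<close> for \<open>n \<ge> 1\<close> is the \<open>n\<close>-th strictly positive zero in ascending order; the
  value \<open>0\<close> at \<open>n = 0\<close> only starts the recursion and is not itself a member of the sequence.
  For \<open>\<mu> > - 1\<close> the positive zeros are infinitely many and do not accumulate at any point of
  \<open>[0, \<infinity>)\<close>, so that the least elements exist.
\<close>

primrec bessel_zero :: "real \<Rightarrow> nat \<Rightarrow> real" where
  "bessel_zero \<mu> 0 = 0"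
| "bessel_zero \<mu> (Suc n) = (LEAST x. bessel_zero \<mu> n < x \<and> bessel_J \<mu> x = 0)"

end

theory Submission
  imports Defs "HOL-Real_Asymp.Real_Asymp"
begin

text \<open>
  Put \<open>w = x\<^sup>2 / 4\<close>. Up to a positive factor, \<open>J\<^sub>\<mu>(x)\<close> is \<open>G\<^sub>a(w)\<close> with \<open>a = \<mu> + 1\<close> and the entire function
  \<open>G\<^sub>a(w) = \<Sum>\<^sub>m (-w)\<^sup>m / (m! (a)\<^sub>m)\<close>, called \<open>clifford a\<close> below, where \<open>(a)\<^sub>m\<close> is the rising factorial.
  If \<open>w\<^sub>k\<close> are the zeros of \<open>G = G\<^sub>a\<close>, then \<open>- G' / G\<close> has the partial fraction expansion
  \<open>\<Sum>\<^sub>k 1 / (w\<^sub>k - z)\<close>, and so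
  \<open>\<Sum>\<^sub>k 1 / (w\<^sub>k - z)\<^sup>2 = (G'\<^sup>2 - G G'') / G\<^sup>2\<close> at \<open>z\<close>.
  Take \<open>G = G\<^bsub>\<nu>+3\<^esub>\<close>, whose zeros belong to \<open>J\<^bsub>\<nu>+2\<^esub>\<close>, and let \<open>z\<close> be a zero of \<open>G\<^bsub>\<nu>+1\<^esub>\<close>. Two steps of
  the recurrence \<open>G\<^sub>a = G\<^bsub>a+1\<^esub> - w / (a (a + 1)) G\<^bsub>a+2\<^esub>\<close> evaluate \<open>- G' / G\<close> at \<open>z\<close> as
  \<open>(\<nu> + 2) / z - 1 / (\<nu> + 1)\<close>, a third one gives \<open>G'' / G\<close>, and the right-hand side becomes
  \<open>1 / (\<nu> + 1)\<^sup>2 - (\<nu> + 2) / z\<^sup>2\<close>. Division by \<open>16\<close> is the claim.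

  The identity for the sum of squares is the analytic part. It is obtained by real-variable means,
  as a limit of the same identity for polynomials with only real roots. Laguerre polynomials have
  only positive simple roots, by an induction with Rolle's theorem (\<open>laguerre_roots\<close>), and with
  their argument divided by their degree they converge to \<open>G\<close> together with their derivatives
  (\<open>scaled_laguerre_convergent\<close>). Their reciprocal roots add up to exactly \<open>1 / a\<close>, so the \<open>k\<close>-th
  root is at least \<open>k a\<close>. Hence roots converge to zeros one by one (\<open>root_tendsto\<close>) and the sums are
  dominated by a multiple of \<open>\<Sum>\<^sub>k 1 / k\<^sup>2\<close> (\<open>sums_inverse_squares\<close>).

  That the zeros can be enumerated in ascending order rests on three facts: they are simple
  (\<open>clifford_zero_simple\<close>), hence isolated, and there are infinitely many of them by a Riccati argument
  (\<open>clifford_oscillates\<close>).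
\<close>

section \<open>The normalised Bessel-Clifford function\<close>

definition clifford_coeff :: "real \<Rightarrow> nat \<Rightarrow> real" where
  "clifford_coeff a m = (-1) ^ m / (fact m * pochhammer a m)"

text \<open>
  The hypergeometric function \<open>\<^sub>0F\<^sub>1(; a; -w)\<close>, that is the Bessel-Clifford function scaled to the
  value \<open>1\<close> at \<open>0\<close>. Up to a positive factor, \<open>J\<^sub>\<mu>(x)\<close> is its value at \<open>w = x\<^sup>2 / 4\<close> for \<open>a = \<mu> + 1\<close>;
  unlike \<open>J\<^sub>\<mu>\<close> it is entire, so no fractional powers occur.
\<close>

definition clifford :: "real \<Rightarrow> real \<Rightarrow> real" where
  "clifford a w = (\<Sum>m. clifford_coeff a m * w ^ m)"

lemma pochhammer_ge_power: "a > 0 \<Longrightarrow> a ^ m \<le> pochhammer a m" for a :: real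
proof (induction m)
  case (Suc m)
  then have "a ^ m * a \<le> pochhammer a m * (a + real m)"
    by (intro mult_mono) (auto intro: pochhammer_nonneg)
  then show ?case by (simp add: pochhammer_rec' mult_ac)
qed simp

lemma abs_clifford_coeff: "a > 0 \<Longrightarrow> \<bar>clifford_coeff a m\<bar> = 1 / (fact m * pochhammer a m)"
  by (simp add: clifford_coeff_def abs_mult power_abs pochhammer_pos less_imp_le)

lemma summable_abs_clifford_coeff:
  assumes "a > 0"
  shows "summable (\<lambda>m. \<bar>clifford_coeff a m\<bar> * x ^ m)"
proof (rule summable_comparison_test)
  show "summable (\<lambda>m. (\<bar>x\<bar> / a) ^ m /\<^sub>R fact m)"
    by (rule summable_exp_generic)
  show "\<exists>N. \<forall>m\<ge>N. norm (\<bar>clifford_coeff a m\<bar> * x ^ m) \<le> (\<bar>x\<bar> / a) ^ m /\<^sub>R fact m"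
  proof (intro exI[of _ 0] allI impI)
    fix m
    have "\<bar>x\<bar> ^ m / (fact m * pochhammer a m) \<le> \<bar>x\<bar> ^ m / (fact m * a ^ m)"
      using assms pochhammer_ge_power[OF assms, of m]
      by (intro divide_left_mono mult_left_mono mult_pos_pos) (auto intro: pochhammer_pos)
    then show "norm (\<bar>clifford_coeff a m\<bar> * x ^ m) \<le> (\<bar>x\<bar> / a) ^ m /\<^sub>R fact m"
      using assms pochhammer_pos[OF assms, of m]
      by (simp add: abs_clifford_coeff abs_mult power_abs power_mult_distrib divide_inverse power_inverse mult_ac)
  qed
qed

lemma summable_clifford_coeff: "a > 0 \<Longrightarrow> summable (\<lambda>m. clifford_coeff a m * x ^ m)"
  using summable_abs_clifford_coeff[of a "\<bar>x\<bar>"]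
  by (intro summable_norm_cancel[of "\<lambda>m. clifford_coeff a m * x ^ m"]) (simp add: abs_mult power_abs)

lemma clifford_sums: "a > 0 \<Longrightarrow> (\<lambda>m. clifford_coeff a m * x ^ m) sums clifford a x"
  unfolding clifford_def by (intro summable_sums summable_clifford_coeff)

lemma clifford_0 [simp]: "clifford a 0 = 1"
  unfolding clifford_def powser_zero by (simp add: clifford_coeff_def)

lemma diffs_clifford_coeff:
  "a > 0 \<Longrightarrow> diffs (clifford_coeff a) m = - (1 / a) * clifford_coeff (a + 1) m"
  unfolding diffs_def clifford_coeff_def by (simp add: pochhammer_rec divide_simps)

lemma clifford_deriv_series:
  assumes "a > 0"
  shows "(\<lambda>m. diffs (clifford_coeff a) m * w ^ m) sums (- clifford (a + 1) w / a)"
  using sums_mult[OF clifford_sums[of "a + 1" w], of "- (1 / a)"] assms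
  by (simp add: diffs_clifford_coeff mult.assoc)

lemma DERIV_clifford:
  assumes "a > 0"
  shows "(clifford a has_real_derivative - clifford (a + 1) w / a) (at w)"
  using termdiffs_strong_converges_everywhere[OF summable_clifford_coeff[OF assms], of w]
  by (simp add: clifford_def[abs_def] sums_unique[OF clifford_deriv_series[OF assms], symmetric])

lemma clifford_deriv2_series:
  assumes "a > 0"
  shows "(\<lambda>m. diffs (diffs (clifford_coeff a)) m * w ^ m) sums (clifford (a + 2) w / (a * (a + 1)))"
proof -
  have "diffs (diffs (clifford_coeff a)) m = - (1 / a) * diffs (clifford_coeff (a + 1)) m" for m
  proof -
    have e: "diffs (clifford_coeff a) = (\<lambda>m. - (1 / a) * clifford_coeff (a + 1) m)"
      using assms by (intro ext diffs_clifford_coeff)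
    show ?thesis unfolding e by (simp add: diffs_def)
  qed
  then show ?thesis
    using sums_mult[OF clifford_deriv_series[of "a + 1" w], of "- (1 / a)"] assms
    by (simp add: mult.assoc add.assoc)
qed

text \<open>
  Read with the two derivative formulas, this contiguity relation is also the differential equation
  \<open>w y'' + a y' + y = 0\<close>.
\<close>

lemma clifford_recurrence:
  assumes "a > 0"
  shows "clifford a w = clifford (a + 1) w - w / (a * (a + 1)) * clifford (a + 2) w"
proof -
  define c where "c = w / (a * (a + 1))"
  have c: "clifford_coeff a (Suc m) - clifford_coeff (a + 1) (Suc m) = - clifford_coeff (a + 2) m / (a * (a + 1))"
    for m
  proof -
    have p: "pochhammer (a + 2) m > 0" using assms by (simp add: pochhammer_pos)
    have e1: "pochhammer a (Suc m) = a * (a + 1) * pochhammer (a + 2) m / (a + 1 + real m)"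
    proof -
      have "pochhammer (a + 1) (Suc m) = (a + 1) * pochhammer (a + 2) m"
        by (simp add: pochhammer_rec add.assoc)
      moreover have "pochhammer (a + 1) (Suc m) = pochhammer (a + 1) m * (a + 1 + real m)"
        by (simp add: pochhammer_rec' mult_ac)
      moreover have "pochhammer a (Suc m) = a * pochhammer (a + 1) m"
        by (simp add: pochhammer_rec)
      ultimately have "pochhammer a (Suc m) * (a + 1 + real m) = a * (a + 1) * pochhammer (a + 2) m"
        by (metis mult.assoc)
      then show ?thesis using assms by (simp add: eq_divide_eq)
    qed
    have e2: "pochhammer (a + 1) (Suc m) = (a + 1) * pochhammer (a + 2) m"
      by (simp add: pochhammer_rec add.assoc)
    define q where "q = pochhammer (a + 2) m"
    define f where "f = (fact m :: real)"
    define s where "s = (-1 :: real) ^ m"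
    have "q > 0" "f > 0" using p by (auto simp: q_def f_def)
    have "- s * (a + 1 + real m) / ((1 + real m) * f * (a * (a + 1) * q))
            + s / ((1 + real m) * f * ((a + 1) * q)) = - (s / (f * q)) / (a * (a + 1))"
      using assms \<open>q > 0\<close> \<open>f > 0\<close> by (simp add: divide_simps) (simp add: algebra_simps)
    then show ?thesis
      unfolding clifford_coeff_def e1 e2 q_def[symmetric] by (simp add: f_def s_def)
  qed
  have "(\<lambda>m. clifford_coeff a m * w ^ m - clifford_coeff (a + 1) m * w ^ m) sums (clifford a w - clifford (a + 1) w)"
    using assms by (intro sums_diff clifford_sums) auto
  moreover have "(\<lambda>m. clifford_coeff a (Suc m) * w ^ Suc m - clifford_coeff (a + 1) (Suc m) * w ^ Suc m)
                   sums (- c * clifford (a + 2) w)"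
  proof -
    have "(\<lambda>m. - c * (clifford_coeff (a + 2) m * w ^ m)) sums (- c * clifford (a + 2) w)"
      using assms by (intro sums_mult clifford_sums) auto
    moreover have "- c * (clifford_coeff (a + 2) m * w ^ m)
        = clifford_coeff a (Suc m) * w ^ Suc m - clifford_coeff (a + 1) (Suc m) * w ^ Suc m" for m
      unfolding left_diff_distrib[symmetric] c c_def by simp
    ultimately show ?thesis by simp
  qed
  ultimately have "clifford a w - clifford (a + 1) w = - c * clifford (a + 2) w"
    by (subst (asm) sums_Suc_iff) (auto simp: clifford_coeff_def dest: sums_unique2)
  then show ?thesis by (simp add: c_def)
qed

text \<open>
  Tannery's theorem for power series. The argument of the series may move as well, which makes the
  convergence locally uniform.
\<close>

lemma dominated_powser_tendsto:
  fixes c :: "nat \<Rightarrow> nat \<Rightarrow> real"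
  assumes lim: "\<And>m. (\<lambda>j. c j m) \<longlonglongrightarrow> c' m"
    and bound: "\<And>j m. \<bar>c j m\<bar> \<le> C m"
    and summ: "\<And>R. summable (\<lambda>m. C m * R ^ m)"
    and X: "X \<longlonglongrightarrow> x"
  shows "(\<lambda>j. \<Sum>m. c j m * X j ^ m) \<longlonglongrightarrow> (\<Sum>m. c' m * x ^ m)"
proof -
  have ev: "eventually (\<lambda>j. \<bar>X j\<bar> < \<bar>x\<bar> + 1) sequentially"
    using tendsto_rabs[OF X] by (rule order_tendstoD) auto
  have "eventually (\<lambda>(m, j). norm (c j m * X j ^ m) \<le> C m * (\<bar>x\<bar> + 1) ^ m) (at_top \<times>\<^sub>F sequentially)"
  proof -
    have "eventually (\<lambda>mj. \<bar>X (snd mj)\<bar> < \<bar>x\<bar> + 1) (at_top \<times>\<^sub>F sequentially)"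
      using ev by (rule eventually_compose_filterlim) (rule filterlim_snd)
    then show ?thesis
    proof (rule eventually_mono, clarify)
      fix m j :: nat assume "\<bar>X (snd (m, j))\<bar> < \<bar>x\<bar> + 1"
      then show "norm (c j m * X j ^ m) \<le> C m * (\<bar>x\<bar> + 1) ^ m"
        using bound[of j m] by (auto simp: abs_mult power_abs intro!: mult_mono power_mono)
    qed
  qed
  then show ?thesis
    by (intro tannerys_theorem[where M = "\<lambda>m. C m * (\<bar>x\<bar> + 1) ^ m", THEN conjunct2, THEN conjunct2])
       (auto intro!: tendsto_intros lim X summ)
qed

lemma clifford_shift_tendsto:
  assumes "a > 0"
  shows "(\<lambda>j. clifford (a + real j) w) \<longlonglongrightarrow> 1"
proof -
  have "(\<lambda>j. \<Sum>m. clifford_coeff (a + real j) m * w ^ m) \<longlonglongrightarrow> (\<Sum>m. (if m = 0 then 1 else 0) * w ^ m)"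
  proof (rule dominated_powser_tendsto)
    fix m
    show "(\<lambda>j. clifford_coeff (a + real j) m) \<longlonglongrightarrow> (if m = 0 then 1 else 0)"
    proof (cases m)
      case (Suc k)
      have "(\<lambda>j. 1 / (a + real j)) \<longlonglongrightarrow> 0"
        by real_asymp
      moreover have "eventually (\<lambda>j. norm (clifford_coeff (a + real j) m) \<le> 1 / (a + real j)) sequentially"
      proof (rule eventually_sequentiallyI[of 1])
        fix j :: nat assume j: "j \<ge> 1"
        have "(1 :: real) * (a + real j) \<le> fact m * pochhammer (a + real j) m"
        proof (rule mult_mono)
          have "(a + real j) ^ 1 \<le> (a + real j) ^ m"
            using j assms Suc by (intro power_increasing) auto
          also have "\<dots> \<le> pochhammer (a + real j) m"
            using assms by (intro pochhammer_ge_power) auto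
          finally show "a + real j \<le> pochhammer (a + real j) m" by simp
        qed (use assms in \<open>auto simp: fact_ge_1\<close>)
        then show "norm (clifford_coeff (a + real j) m) \<le> 1 / (a + real j)"
          using assms by (simp add: abs_clifford_coeff frac_le)
      qed
      ultimately show ?thesis
        using Suc by (auto intro: Lim_null_comparison)
    qed (simp add: clifford_coeff_def)
  next
    fix j m
    have "pochhammer a m \<le> pochhammer (a + real j) m"
      unfolding pochhammer_prod using assms by (intro prod_mono) auto
    then show "\<bar>clifford_coeff (a + real j) m\<bar> \<le> \<bar>clifford_coeff a m\<bar>"
      using assms by (simp add: abs_clifford_coeff pochhammer_pos frac_le)
  qed (use assms in \<open>auto intro: summable_abs_clifford_coeff\<close>)
  also have "(\<Sum>m. (if m = 0 then 1 else 0) * w ^ m) = 1"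
    using powser_zero[of "\<lambda>m. w ^ m"] suminf_finite[of "{0}" "\<lambda>m. (if m = 0 then 1 else 0) * w ^ m"] by simp
  finally show ?thesis by (simp add: clifford_def)
qed

text \<open>
  If \<open>w\<close> were a zero of two neighbouring functions, then the recurrence would make it a zero of all
  functions with parameters \<open>a + j\<close>; but these tend to \<open>1\<close> at \<open>w\<close>. As \<open>clifford (a + 1)\<close> is a multiple
  of the derivative of \<open>clifford a\<close>, the zeros are simple.
\<close>

lemma clifford_zero_simple:
  assumes a: "a > 0" and w: "clifford a w = 0"
  shows "clifford (a + 1) w \<noteq> 0"
proof
  assume w1: "clifford (a + 1) w = 0"
  have "w \<noteq> 0" using w by auto
  have "clifford (a + real j) w = 0 \<and> clifford (a + real j + 1) w = 0" for j
  proof (induction j)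
    case (Suc j)
    have "a + real j > 0" using a by simp
    from clifford_recurrence[OF this, of w] Suc \<open>w \<noteq> 0\<close> this show ?case
      by (auto simp: add_ac)
  qed (use w w1 in auto)
  then have "(\<lambda>j. clifford (a + real j) w) \<longlonglongrightarrow> 0" by simp
  with clifford_shift_tendsto[OF a, of w] show False
    using LIMSEQ_unique by fastforce
qed

section \<open>Positive roots of Laguerre polynomials\<close>

text \<open>
  The Laguerre polynomial \<open>L\<^sub>n\<close> of order \<open>a - 1\<close>, scaled to the value \<open>1\<close> at \<open>0\<close>.
\<close>

definition laguerre :: "real \<Rightarrow> nat \<Rightarrow> real poly" where
  "laguerre a n = (\<Sum>m\<le>n. monom (of_nat (n choose m) * (-1) ^ m / pochhammer a m) m)"

lemma coeff_laguerre:
  "coeff (laguerre a n) m = of_nat (n choose m) * (-1) ^ m / pochhammer a m"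
  unfolding laguerre_def by (simp add: coeff_sum if_distrib[of "\<lambda>p. coeff p m"] coeff_monom binomial_eq_0)

lemma degree_laguerre: "a > 0 \<Longrightarrow> degree (laguerre a n) = n"
  by (rule order_antisym[OF degree_le le_degree])
     (auto simp: coeff_laguerre binomial_eq_0 pochhammer_pos less_imp_neq[THEN not_sym])

lemma laguerre_neq_0: "a > 0 \<Longrightarrow> laguerre a n \<noteq> 0"
  by (metis coeff_0 coeff_laguerre binomial_n_0 of_nat_1 pochhammer_0 power_0 mult_1 div_by_1 zero_neq_one)

text \<open>
  The right-hand side is \<open>x p' + (n + a - x) p\<close> for \<open>p = laguerre a n\<close>. Therefore
  \<open>x\<^bsup>n+a\<^esup> e\<^bsup>-x\<^esup> p\<close> has the derivative \<open>(n + a) x\<^bsup>n+a-1\<^esup> e\<^bsup>-x\<^esup> laguerre a (Suc n)\<close>, which is what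
  lets Rolle's theorem produce the zeros of the next polynomial.
\<close>

lemma laguerre_raise:
  assumes "a > 0"
  shows "smult (real n + a) (laguerre a (Suc n)) =
           pCons 0 (pderiv (laguerre a n)) + [:real n + a, -1:] * laguerre a n"
proof (rule poly_eqI)
  fix m
  show "coeff (smult (real n + a) (laguerre a (Suc n))) m =
     coeff (pCons 0 (pderiv (laguerre a n)) + [:real n + a, -1:] * laguerre a n) m"
  proof (cases m)
    case (Suc k)
    have p: "pochhammer a k > 0" "a + real k > 0" using assms by (auto simp: pochhammer_pos)
    have "real (Suc k) * real (n choose Suc k) = (real n - real k) * real (n choose k)"
    proof (cases "k \<le> n")
      case True
      have "Suc k * (n choose Suc k) = (n - k) * (n choose k)"
        by (metis binomial_absorption binomial_absorb_comp)
      then have "real (Suc k * (n choose Suc k)) = real ((n - k) * (n choose k))" by simp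
      then show ?thesis using True by (simp only: of_nat_mult of_nat_diff)
    qed (simp add: binomial_eq_0)
    then have e: "(1 + real k) * real (n choose Suc k) = (real n - real k) * real (n choose k)"
      by simp
    have "(real n + a) * (real (n choose k) + real (n choose Suc k)) =
          (1 + real k) * real (n choose Suc k) + (real n + a) * real (n choose Suc k) + (a + real k) * real (n choose k)"
      using e by (simp add: algebra_simps)
    then have "(real n + a) * ((real (n choose k) + real (n choose Suc k)) / (pochhammer a k * (a + real k))) =
          ((1 + real k) * real (n choose Suc k) + (real n + a) * real (n choose Suc k)) / (pochhammer a k * (a + real k))
          + real (n choose k) / pochhammer a k"
      using p by (simp add: divide_simps)
    from arg_cong[OF this, of "\<lambda>u. - ((-1) ^ k) * u"] show ?thesis
      using Suc by (simp add: coeff_laguerre coeff_pderiv pochhammer_rec' mult_ac)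
         (simp add: add_divide_distrib diff_divide_distrib algebra_simps)
  qed (simp add: coeff_laguerre)
qed

text \<open>
  A function that vanishes at \<open>a\<close> and at infinity takes every value strictly between \<open>0\<close> and
  \<open>f (a + 1)\<close> on both sides of \<open>a + 1\<close>, and Rolle's theorem applies between two such points.
\<close>

lemma Rolle_at_top:
  fixes f :: "real \<Rightarrow> real"
  assumes f: "f a = 0" and lim: "(f \<longlongrightarrow> 0) at_top"
    and cont: "continuous_on {a..} f"
    and der: "\<And>x. x > a \<Longrightarrow> (f has_real_derivative f' x) (at x)"
  shows "\<exists>x>a. f' x = 0"
proof -
  have "\<exists>x y. a \<le> x \<and> x < y \<and> f x = f y"
  proof (cases "f (a + 1) = 0")
    case True
    then show ?thesis using f by (intro exI[of _ a] exI[of _ "a + 1"]) auto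
  next
    case False
    define g where "g x = f x / f (a + 1)" for x
    have g: "g a = 0" "g (a + 1) = 1" using f False by (auto simp: g_def)
    have cont_g: "continuous_on A g" if "A \<subseteq> {a..}" for A
      unfolding g_def using False by (intro continuous_intros continuous_on_subset[OF cont that]) auto
    have "(g \<longlongrightarrow> 0) at_top"
      using tendsto_divide[OF lim tendsto_const[of "f (a + 1)"]] False by (simp add: g_def[abs_def])
    then have "eventually (\<lambda>x. g x < 1 / 2) at_top"
      by (rule order_tendstoD) simp
    then have "eventually (\<lambda>x. g x < 1 / 2 \<and> x > a + 1) at_top"
      using eventually_gt_at_top by (rule eventually_conj)
    then obtain X where X: "g X < 1 / 2" "X > a + 1"
      using eventually_happens'[OF trivial_limit_at_top_linorder] by blast
    obtain x where x: "a \<le> x" "x \<le> a + 1" "g x = 1 / 2"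
      using IVT'[of g a "1/2" "a + 1"] g cont_g[of "{a..a+1}"] by auto
    obtain y where y: "a + 1 \<le> y" "y \<le> X" "g y = 1 / 2"
      using IVT2'[of g X "1/2" "a + 1"] g X cont_g[of "{a+1..X}"] by auto
    have "x \<noteq> a + 1" using x g by auto
    then show ?thesis
      using x y False by (intro exI[of _ x] exI[of _ y]) (auto simp: g_def field_simps)
  qed
  then obtain x y where xy: "a \<le> x" "x < y" "f x = f y" by blast
  have "\<exists>z>x. z < y \<and> (\<lambda>h. f' z * h) = (\<lambda>h. 0)"
  proof (rule Rolle_deriv)
    show "continuous_on {x..y} f" using xy by (intro continuous_on_subset[OF cont]) auto
    show "(f has_derivative (\<lambda>h. f' z * h)) (at z)" if "x < z" "z < y" for z
      using der[of z] xy that by (simp add: has_field_derivative_def)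
  qed (use xy in auto)
  then obtain z where "z > x" "f' z * 1 = 0" by metis
  then show ?thesis using xy by (intro exI[of _ z]) auto
qed

text \<open>
  The function \<open>x\<^bsup>n+a\<^esup> e\<^bsup>-x\<^esup> laguerre a n\<close> vanishes at \<open>0\<close>, at \<open>n\<close> positive points and at infinity;
  Rolle's theorem gives its derivative, and so \<open>laguerre a (Suc n)\<close>, \<open>n + 1\<close> positive zeros. The
  entry \<open>r 0 = 0\<close> is that extra zero and not a root of the polynomial.
\<close>

lemma laguerre_roots_aux:
  assumes a: "a > 0"
  shows "\<exists>r. r 0 = 0 \<and> (\<forall>i<n. r i < r (Suc i)) \<and> (\<forall>i\<in>{1..n}. poly (laguerre a n) (r i) = 0)"
proof (induction n)
  case 0
  show ?case by (intro exI[of _ "\<lambda>_. 0"]) auto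
next
  case (Suc n)
  then obtain r where r0: "r 0 = 0" and r_mono: "\<And>i. i < n \<Longrightarrow> r i < r (Suc i)"
    and r_root: "\<And>i. i \<in> {1..n} \<Longrightarrow> poly (laguerre a n) (r i) = 0" by blast
  have r_nonneg: "r i \<ge> 0" if "i \<le> n" for i
    using that
  proof (induction i)
    case (Suc i)
    then show ?case using r_mono[of i] by auto
  qed (simp add: r0)
  define c where "c = real n + a"
  have c: "c > 0" using a by (simp add: c_def)
  define f where "f = (\<lambda>x. x powr c * exp (- x) * poly (laguerre a n) x)"
  define f' where "f' = (\<lambda>x. x powr (c - 1) * exp (- x) * (c * poly (laguerre a (Suc n)) x))"
  have f0: "f (r i) = 0" if "i \<le> n" for i
    using that r_root[of i] r0 c by (cases "i = 0") (auto simp: f_def)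
  have der: "(f has_real_derivative f' x) (at x)" if "x > 0" for x
  proof -
    have e: "c * poly (laguerre a (Suc n)) x =
       x * poly (pderiv (laguerre a n)) x + (c - x) * poly (laguerre a n) x"
      using arg_cong[OF laguerre_raise[OF a, of n], of "\<lambda>p. poly p x"]
      by (simp add: c_def algebra_simps)
    have "x powr c = x * x powr (c - 1)"
      using that by (simp add: powr_mult_base)
    moreover have "(f has_real_derivative
        c * x powr (c - 1) * exp (- x) * poly (laguerre a n) x + x powr c * (- exp (- x)) * poly (laguerre a n) x
          + x powr c * exp (- x) * poly (pderiv (laguerre a n)) x) (at x)"
      unfolding f_def using that
      by (auto intro!: derivative_eq_intros DERIV_powr simp: algebra_simps)
    ultimately show ?thesis
      unfolding f'_def e by (simp add: algebra_simps)
  qed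
  have cont: "continuous_on {0..} f"
    unfolding f_def using c by (intro continuous_intros continuous_on_powr') auto
  have lim: "(f \<longlongrightarrow> 0) at_top"
  proof -
    have "((\<lambda>x. x powr c * exp (- x) * x ^ m) \<longlongrightarrow> 0) at_top" for m
      by real_asymp
    then have "((\<lambda>x. \<Sum>m\<le>degree (laguerre a n). coeff (laguerre a n) m * (x powr c * exp (- x) * x ^ m)) \<longlongrightarrow> 0) at_top"
      by (intro tendsto_null_sum tendsto_mult_right_zero)
    then show ?thesis
      by (simp add: f_def poly_altdef sum_distrib_left mult_ac)
  qed
  have "\<exists>x. r i < x \<and> (i < n \<longrightarrow> x < r (Suc i)) \<and> f' x = 0" if "i \<le> n" for i
  proof (cases "i < n")
    case True
    have "\<exists>z>r i. z < r (Suc i) \<and> f' z = 0"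
    proof -
      have "\<exists>z>r i. z < r (Suc i) \<and> (\<lambda>h. f' z * h) = (\<lambda>h. 0)"
      proof (rule Rolle_deriv)
        show "continuous_on {r i..r (Suc i)} f"
          using r_nonneg[OF that] by (intro continuous_on_subset[OF cont]) auto
        show "(f has_derivative (\<lambda>h. f' z * h)) (at z)" if "r i < z" for z
          using der[of z] r_nonneg[OF \<open>i \<le> n\<close>] that by (simp add: has_field_derivative_def)
      qed (use f0 True r_mono in auto)
      then show ?thesis by (metis mult.right_neutral)
    qed
    then show ?thesis using True by auto
  next
    case False
    then have "i = n" using that by simp
    have "\<exists>x>r n. f' x = 0"
    proof (rule Rolle_at_top[OF _ lim _ der])
      show "f (r n) = 0" using f0 by simp
      show "continuous_on {r n..} f" using r_nonneg[of n] by (intro continuous_on_subset[OF cont]) auto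
      show "x > r n \<Longrightarrow> x > 0" for x using r_nonneg[of n] by auto
    qed
    then show ?thesis using \<open>i = n\<close> by auto
  qed
  then obtain x where x': "\<And>i. i \<le> n \<Longrightarrow> r i < x i \<and> (i < n \<longrightarrow> x i < r (Suc i)) \<and> f' (x i) = 0"
    by metis
  have x: "\<And>i. i \<le> n \<Longrightarrow> r i < x i" "\<And>i. i < n \<Longrightarrow> x i < r (Suc i)"
      "\<And>i. i \<le> n \<Longrightarrow> f' (x i) = 0"
    using x' by auto
  have root: "poly (laguerre a (Suc n)) (x i) = 0" if "i \<le> n" for i
    using x(1,3)[OF that] r_nonneg[OF that] c by (auto simp: f'_def)
  show ?case
  proof (intro exI[of _ "case_nat 0 x"] conjI allI impI ballI)
    fix i assume i: "i < Suc n"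
    show "(case i of 0 \<Rightarrow> 0 | Suc i \<Rightarrow> x i) < (case Suc i of 0 \<Rightarrow> 0 | Suc i \<Rightarrow> x i)"
    proof (cases i)
      case 0
      then show ?thesis using x(1)[of 0] r0 by simp
    next
      case (Suc j)
      then show ?thesis using x(2)[of j] x(1)[of "Suc j"] i by simp
    qed
  next
    fix i assume "i \<in> {1..Suc n}"
    then show "poly (laguerre a (Suc n)) (case i of 0 \<Rightarrow> 0 | Suc i \<Rightarrow> x i) = 0"
      using root by (cases i) simp_all
  qed simp
qed

lemma laguerre_roots:
  assumes a: "a > 0"
  shows "card {x. poly (laguerre a n) x = 0} = n" "\<And>x. poly (laguerre a n) x = 0 \<Longrightarrow> x > 0"
proof -
  obtain r where r0: "r 0 = (0 :: real)" and r_mono: "\<And>i. i < n \<Longrightarrow> r i < r (Suc i)"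
    and r_root: "\<And>i. i \<in> {1..n} \<Longrightarrow> poly (laguerre a n) (r i) = 0"
    using laguerre_roots_aux[OF a, of n] by metis
  let ?S = "{x. poly (laguerre a n) x = 0}"
  have less: "r i < r j" if "i < j" "j \<le> n" for i j
    using that
  proof (induction j)
    case (Suc j)
    then show ?case using r_mono[of j] by (cases "i = j") auto
  qed simp
  have fin: "finite ?S"
    using laguerre_neq_0[OF a] by (rule poly_roots_finite)
  have sub: "r ` {1..n} \<subseteq> ?S" using r_root by auto
  have "inj_on r {1..n}"
    using less by (intro linorder_inj_onI) (auto simp: less_imp_neq)
  then have c: "card (r ` {1..n}) = n" by (simp add: card_image)
  have "card ?S \<le> n"
    using card_poly_roots_bound[OF laguerre_neq_0[OF a]] degree_laguerre[OF a] by metis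
  with c sub fin have eq: "r ` {1..n} = ?S" by (intro card_seteq) auto
  show "card ?S = n" using c unfolding eq .
  show "x > 0" if "poly (laguerre a n) x = 0" for x
  proof -
    have "x \<in> r ` {1..n}" using that unfolding eq by simp
    then obtain i where "i \<in> {1..n}" "x = r i" by blast
    then show ?thesis using less[of 0 i] r0 by simp
  qed
qed

section \<open>Inverse squares of the zeros of a limit of real-rooted polynomials\<close>

text \<open>
  This is locally uniform convergence to a continuous limit, stated by sequences. Subsequences are
  built in because the roots to which it is applied come from a compactness argument.
\<close>

definition continuously_convergent :: "(nat \<Rightarrow> real \<Rightarrow> real) \<Rightarrow> (real \<Rightarrow> real) \<Rightarrow> bool" where
  "continuously_convergent f F \<longleftrightarrow>
     (\<forall>s X x. strict_mono s \<longrightarrow> X \<longlonglongrightarrow> x \<longrightarrow> (\<lambda>j. f (s j) (X j)) \<longlonglongrightarrow> F x)"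

lemma continuously_convergentD:
  "continuously_convergent f F \<Longrightarrow> strict_mono s \<Longrightarrow> X \<longlonglongrightarrow> x \<Longrightarrow> (\<lambda>j. f (s j) (X j)) \<longlonglongrightarrow> F x"
  by (auto simp: continuously_convergent_def)

lemma continuously_convergent_pointwise:
  "continuously_convergent f F \<Longrightarrow> (\<lambda>n. f n x) \<longlonglongrightarrow> F x"
  using continuously_convergentD[of f F id "\<lambda>_. x" x] by (simp add: strict_mono_id)

lemma sign_change_at_simple_zero:
  fixes F :: "real \<Rightarrow> real"
  assumes "F w = 0" "(F has_real_derivative d) (at w)" "d \<noteq> 0" "e > 0"
  obtains x y where "w - e < x" "x < y" "y < w + e" "F x * F y < 0"
proof -
  obtain \<delta> where \<delta>: "\<delta> > 0" "\<And>h. 0 < h \<Longrightarrow> h < \<delta> \<Longrightarrow> F (w - h) * F (w + h) < 0"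
  proof (cases "d > 0")
    case True
    obtain d1 d2 where "d1 > 0" "\<forall>h>0. h < d1 \<longrightarrow> F w < F (w + h)"
        "d2 > 0" "\<forall>h>0. h < d2 \<longrightarrow> F (w - h) < F w"
      using DERIV_pos_inc_right[OF assms(2) True] DERIV_pos_inc_left[OF assms(2) True] by blast
    then show ?thesis using assms(1)
      by (intro that[of "min d1 d2"]) (auto simp: mult_less_0_iff)
  next
    case False
    then have "d < 0" using assms by simp
    obtain d1 d2 where "d1 > 0" "\<forall>h>0. h < d1 \<longrightarrow> F w > F (w + h)"
        "d2 > 0" "\<forall>h>0. h < d2 \<longrightarrow> F (w - h) > F w"
      using DERIV_neg_dec_right[OF assms(2) \<open>d < 0\<close>] DERIV_neg_dec_left[OF assms(2) \<open>d < 0\<close>] by blast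
    then show ?thesis using assms(1)
      by (intro that[of "min d1 d2"]) (auto simp: mult_less_0_iff)
  qed
  define h where "h = min \<delta> e / 2"
  have "0 < h" "h < \<delta>" "h < e" using \<delta>(1) assms(4) by (auto simp: h_def)
  then show ?thesis using \<delta>(2)[of h] by (intro that[of "w - h" "w + h"]) auto
qed

lemma poly_root_near_simple_zero:
  assumes conv: "continuously_convergent (\<lambda>n. poly (q n)) F"
    and "F w = 0" "(F has_real_derivative d) (at w)" "d \<noteq> 0" "e > 0"
  shows "eventually (\<lambda>n. \<exists>s. \<bar>s - w\<bar> < e \<and> poly (q n) s = 0) sequentially"
proof -
  obtain x y where xy: "w - e < x" "x < y" "y < w + e" "F x * F y < 0"
    using sign_change_at_simple_zero[OF assms(2-5)] .
  have "(\<lambda>n. poly (q n) x * poly (q n) y) \<longlonglongrightarrow> F x * F y"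
    by (intro tendsto_mult continuously_convergent_pointwise[OF conv])
  then have "eventually (\<lambda>n. poly (q n) x * poly (q n) y < 0) sequentially"
    using xy(4) by (rule order_tendstoD)
  then show ?thesis
  proof eventually_elim
    case (elim n)
    then obtain s where "x < s" "s < y" "poly (q n) s = 0"
      using poly_IVT[OF \<open>x < y\<close>, of "q n"] by auto
    then show ?case using xy by (intro exI[of _ s]) auto
  qed
qed

text \<open>
  For \<open>p = c \<Prod>(X - x)\<close> these are the values of \<open>p' / p\<close> and of \<open>- (p' / p)'\<close> at \<open>z\<close>, freed of
  denominators.
\<close>

lemma real_rooted_log_derivatives:
  fixes p :: "real poly"
  assumes "finite S" "p \<noteq> 0" "degree p = card S" "\<And>x. x \<in> S \<Longrightarrow> poly p x = 0" "z \<notin> S"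
  shows "poly (pderiv p) z = - poly p z * (\<Sum>x\<in>S. 1 / (x - z)) \<and>
         (poly (pderiv p) z)\<^sup>2 - poly p z * poly (pderiv (pderiv p)) z
            = (poly p z)\<^sup>2 * (\<Sum>x\<in>S. 1 / (x - z)\<^sup>2)"
  using assms
proof (induction S arbitrary: p rule: finite_induct)
  case empty
  then obtain c where "p = [:c:]" by (metis card.empty degree_eq_zeroE)
  then show ?case by (simp add: pderiv_pCons)
next
  case (insert a S)
  have "poly p a = 0" using insert by simp
  then obtain r where p: "p = [:-a, 1:] * r" by (metis poly_eq_0_iff_dvd dvdE)
  have "r \<noteq> 0" using insert p by auto
  have "degree p = 1 + degree r" using \<open>r \<noteq> 0\<close> unfolding p by (subst degree_mult_eq) auto
  then have "degree r = card S" using insert by simp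
  moreover have "poly r x = 0" if "x \<in> S" for x
    using insert.prems(3)[of x] that insert.hyps p by auto
  ultimately have IH: "poly (pderiv r) z = - poly r z * (\<Sum>x\<in>S. 1 / (x - z))"
      "(poly (pderiv r) z)\<^sup>2 - poly r z * poly (pderiv (pderiv r)) z = (poly r z)\<^sup>2 * (\<Sum>x\<in>S. 1 / (x - z)\<^sup>2)"
    using insert.IH[of r] \<open>r \<noteq> 0\<close> insert.prems by auto
  define u where "u = z - a"
  have u: "u \<noteq> 0" "a - z = - u" using insert.prems by (auto simp: u_def)
  have p0: "poly p z = u * poly r z" by (simp add: p u_def algebra_simps)
  have lin: "pderiv [:-a, 1:] = 1"
    by (simp add: pderiv_pCons one_pCons)
  have dp: "pderiv p = [:-a, 1:] * pderiv r + r"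
    unfolding p pderiv_mult lin by (simp only: mult_1_right)
  have ddp: "pderiv (pderiv p) = [:-a, 1:] * pderiv (pderiv r) + pderiv r + pderiv r"
    unfolding dp pderiv_add pderiv_mult lin by (simp only: mult_1_right)
  have p1: "poly (pderiv p) z = poly r z + u * poly (pderiv r) z"
    unfolding dp by (simp add: u_def algebra_simps)
  have p2: "poly (pderiv (pderiv p)) z = 2 * poly (pderiv r) z + u * poly (pderiv (pderiv r)) z"
    unfolding ddp by (simp add: u_def algebra_simps)
  have s1: "(\<Sum>x\<in>insert a S. 1 / (x - z)) = - (1 / u) + (\<Sum>x\<in>S. 1 / (x - z))"
    and s2: "(\<Sum>x\<in>insert a S. 1 / (x - z)\<^sup>2) = 1 / u\<^sup>2 + (\<Sum>x\<in>S. 1 / (x - z)\<^sup>2)"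
    using insert.hyps u by simp_all
  have "poly (pderiv p) z = - poly p z * (\<Sum>x\<in>insert a S. 1 / (x - z))"
    using u(1) unfolding p0 p1 IH(1) s1 by (simp add: field_simps)
  moreover have "(poly (pderiv p) z)\<^sup>2 - poly p z * poly (pderiv (pderiv p)) z
      = (poly r z)\<^sup>2 + u\<^sup>2 * ((poly (pderiv r) z)\<^sup>2 - poly r z * poly (pderiv (pderiv r)) z)"
    unfolding p0 p1 p2 by (simp add: power2_eq_square algebra_simps)
  then have "(poly (pderiv p) z)\<^sup>2 - poly p z * poly (pderiv (pderiv p)) z
     = (poly p z)\<^sup>2 * (\<Sum>x\<in>insert a S. 1 / (x - z)\<^sup>2)"
    using u(1) unfolding p0 IH(2) s2 by (simp add: distrib_left power_mult_distrib mult_ac)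
  ultimately show ?case by simp
qed

text \<open>
  Real-rooted polynomials \<open>q n\<close> converge to \<open>F\<close> and their first two derivatives to \<open>F'\<close> and \<open>F''\<close>.
  The zeros of \<open>F\<close> are simple, and those in \<open>[0, \<infinity>)\<close> start with \<open>w 0 < w 1 < \<dots>\<close>. The bound \<open>B\<close> on
  the sums of the reciprocal roots keeps roots from crowding together: it forces the \<open>k\<close>-th root of
  every \<open>q n\<close> to be at least of the order of \<open>k\<close>.
\<close>

locale real_rooted_limit =
  fixes q :: "nat \<Rightarrow> real poly" and F F' F'' :: "real \<Rightarrow> real" and w :: "nat \<Rightarrow> real" and B :: real
  assumes conv: "continuously_convergent (\<lambda>n. poly (q n)) F"
      "continuously_convergent (\<lambda>n. poly (pderiv (q n))) F'"
      "continuously_convergent (\<lambda>n. poly (pderiv (pderiv (q n)))) F''"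
    and deriv: "\<And>x. (F has_real_derivative F' x) (at x)"
    and simple: "\<And>x. F x = 0 \<Longrightarrow> F' x \<noteq> 0"
    and q_neq_0: "\<And>n. q n \<noteq> 0"
    and card_roots: "\<And>n. card {x. poly (q n) x = 0} = degree (q n)"
    and roots_pos: "\<And>n x. poly (q n) x = 0 \<Longrightarrow> x > 0"
    and reciprocal_sum: "\<And>n. (\<Sum>x | poly (q n) x = 0. 1 / x) \<le> B"
    and w_mono: "strict_mono w"
    and w_zero: "\<And>k. F (w k) = 0"
    and w_all: "\<And>k y. F y = 0 \<Longrightarrow> 0 \<le> y \<Longrightarrow> y < w k \<Longrightarrow> \<exists>i<k. y = w i"
begin

text \<open>
  The roots of \<open>q n\<close> in ascending order, counted from \<open>0\<close>; meaningful for \<open>k < degree (q n)\<close>.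
\<close>

definition ordered_root :: "nat \<Rightarrow> nat \<Rightarrow> real" where
  "ordered_root n k = sorted_list_of_set {x. poly (q n) x = 0} ! k"

lemma finite_roots: "finite {x. poly (q n) x = 0}"
  using q_neq_0 by (rule poly_roots_finite)

lemma bij_betw_root: "bij_betw (ordered_root n) {..<degree (q n)} {x. poly (q n) x = 0}"
  unfolding ordered_root_def[abs_def]
  by (rule bij_betw_nth) (simp_all add: finite_roots card_roots)

lemma poly_root: "k < degree (q n) \<Longrightarrow> poly (q n) (ordered_root n k) = 0"
  using bij_betw_root[of n] by (auto simp: bij_betw_def)

lemma root_pos: "k < degree (q n) \<Longrightarrow> ordered_root n k > 0"
  using poly_root roots_pos by blast

lemma root_mono: "i < j \<Longrightarrow> j < degree (q n) \<Longrightarrow> ordered_root n i < ordered_root n j"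
  unfolding ordered_root_def using sorted_wrt_nth_less[OF strict_sorted_list_of_set, of i j "{x. poly (q n) x = 0}"]
  by (simp add: card_roots)

text \<open>
  The first \<open>k + 1\<close> roots contribute at least \<open>(k + 1) / ordered_root n k\<close> to the sum of the
  reciprocals.
\<close>

lemma root_ge:
  assumes "k < degree (q n)"
  shows "real (Suc k) \<le> B * ordered_root n k"
proof -
  have pos: "ordered_root n k > 0" using root_pos assms .
  have "real (Suc k) / ordered_root n k = (\<Sum>i<Suc k. 1 / ordered_root n k)" by simp
  also have "\<dots> \<le> (\<Sum>i<Suc k. 1 / ordered_root n i)"
  proof (rule sum_mono)
    fix i assume "i \<in> {..<Suc k}"
    then have "ordered_root n i \<le> ordered_root n k" "ordered_root n i > 0"
      using assms root_mono[of i k n] root_pos[of i n] by (auto simp: less_Suc_eq)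
    then show "1 / ordered_root n k \<le> 1 / ordered_root n i" by (simp add: frac_le)
  qed
  also have "\<dots> \<le> (\<Sum>i<degree (q n). 1 / ordered_root n i)"
    using assms by (intro sum_mono2) (auto intro!: less_imp_le root_pos)
  also have "\<dots> = (\<Sum>x | poly (q n) x = 0. 1 / x)"
    by (rule sum.reindex_bij_betw[OF bij_betw_root])
  also have "\<dots> \<le> B" by (rule reciprocal_sum)
  finally show ?thesis using pos by (simp add: field_simps)
qed

text \<open>
  The sign change of \<open>F\<close> at \<open>w k\<close> gives \<open>q n\<close> a root near \<open>w k\<close>, which by induction is none of the
  first \<open>k\<close> roots; so the next root is eventually below \<open>w k + e\<close>. If it failed to converge to \<open>w k\<close>,
  a subsequence would converge to a smaller zero \<open>w i\<close> of \<open>F\<close>, towards which the \<open>i\<close>-th root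
  converges too. Rolle's theorem between these two roots then makes \<open>w i\<close> a double zero.
\<close>

lemma root_tendsto: "eventually (\<lambda>n. k < degree (q n)) sequentially \<and> (\<lambda>n. ordered_root n k) \<longlonglongrightarrow> w k"
proof (induction k rule: less_induct)
  case (less k)
  have upper: "eventually (\<lambda>n. k < degree (q n) \<and> ordered_root n k < w k + e) sequentially" if "e > 0" for e
  proof -
    obtain d where d: "d > 0" "d \<le> e" "\<And>i. i < k \<Longrightarrow> w i < w k - d"
    proof (cases k)
      case 0
      then show ?thesis using that[of e] \<open>e > 0\<close> by simp
    next
      case (Suc l)
      define d where "d = min e ((w k - w l) / 2)"
      have "w l < w k" using w_mono Suc by (auto simp: strict_mono_def)
      have "w i < w k - d" if "i < k" for i
      proof -
        have "w i \<le> w l" using w_mono that Suc by (simp add: strict_mono_less_eq)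
        also have "w l < w k - d" using \<open>w l < w k\<close> by (auto simp: d_def min_def field_simps)
        finally show ?thesis .
      qed
      then show ?thesis using that[of d] \<open>w l < w k\<close> \<open>e > 0\<close> by (simp add: d_def)
    qed
    have "eventually (\<lambda>n. \<exists>s. \<bar>s - w k\<bar> < d \<and> poly (q n) s = 0) sequentially"
      by (rule poly_root_near_simple_zero[OF conv(1) w_zero deriv simple[OF w_zero] d(1)])
    moreover have "eventually (\<lambda>n. \<forall>i\<in>{..<k}. ordered_root n i < w k - d) sequentially"
    proof (rule eventually_ball_finite)
      show "\<forall>i\<in>{..<k}. eventually (\<lambda>n. ordered_root n i < w k - d) sequentially"
        using less d(3) by (metis lessThan_iff order_tendstoD(2))
    qed simp
    ultimately show ?thesis
    proof eventually_elim
      case (elim n)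
      then obtain s where s: "\<bar>s - w k\<bar> < d" "poly (q n) s = 0" by blast
      then obtain j where j: "j < degree (q n)" "s = ordered_root n j"
        using bij_betw_root[of n] by (auto simp: bij_betw_def)
      have "k \<le> j"
      proof (rule ccontr)
        assume "\<not> k \<le> j"
        with elim(2) have "ordered_root n j < w k - d" by simp
        with s(1) j(2) show False by linarith
      qed
      then have "ordered_root n k \<le> ordered_root n j" using root_mono[of k j n] j by (cases "k = j") auto
      then show ?case using \<open>k \<le> j\<close> j s d by auto
    qed
  qed
  have "(\<lambda>n. ordered_root n k) \<longlonglongrightarrow> w k"
  proof (rule ccontr)
    assume "\<not> (\<lambda>n. ordered_root n k) \<longlonglongrightarrow> w k"
    then obtain e where e: "e > 0" "\<not> eventually (\<lambda>n. \<bar>ordered_root n k - w k\<bar> < e) sequentially"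
      by (auto simp: tendsto_iff dist_real_def)
    define N where "N = {n. k < degree (q n) \<and> ordered_root n k \<le> w k - e}"
    have "infinite N"
    proof
      assume "finite N"
      then have "eventually (\<lambda>n. n \<notin> N) sequentially"
        unfolding cofinite_eq_sequentially[symmetric] by (simp add: eventually_cofinite)
      with upper[OF e(1)] have "eventually (\<lambda>n. \<bar>ordered_root n k - w k\<bar> < e) sequentially"
        by eventually_elim (auto simp: N_def)
      with e(2) show False by simp
    qed
    then obtain s :: "nat \<Rightarrow> nat" where s: "strict_mono s" "\<And>n. s n \<in> N"
      using infinite_enumerate by blast
    have in_Icc: "ordered_root (s n) k \<in> {0..w k - e}" for n
      using s(2)[of n] root_pos[of k "s n"] by (auto simp: N_def)
    have "seq_compact {0..w k - e}"
      by (intro compact_imp_seq_compact compact_Icc)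
    then obtain l t where lt: "l \<in> {0..w k - e}" "strict_mono (t :: nat \<Rightarrow> nat)"
        "((\<lambda>n. ordered_root (s n) k) \<circ> t) \<longlonglongrightarrow> l"
      by (rule seq_compactE[where f = "\<lambda>n. ordered_root (s n) k"]) (use in_Icc in auto)
    define r where "r = s \<circ> t"
    have r: "strict_mono r" "\<And>n. r n \<in> N"
      using s lt by (auto simp: r_def strict_mono_o)
    have lim: "(\<lambda>n. ordered_root (r n) k) \<longlonglongrightarrow> l" using lt(3) by (simp add: o_def r_def)
    have "(\<lambda>n. poly (q (r n)) (ordered_root (r n) k)) \<longlonglongrightarrow> F l"
      by (rule continuously_convergentD[OF conv(1) r(1) lim])
    moreover have "poly (q (r n)) (ordered_root (r n) k) = 0" for n
      using r(2)[of n] by (intro poly_root) (simp add: N_def)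
    ultimately have "F l = 0" by (simp add: LIMSEQ_const_iff)
    then obtain i where i: "i < k" "l = w i"
      using w_all[of l k] lt(1) e(1) by auto
    have lim_i: "(\<lambda>n. ordered_root (r n) i) \<longlonglongrightarrow> l"
      using less[OF i(1)] LIMSEQ_subseq_LIMSEQ[OF _ r(1), of "\<lambda>n. ordered_root n i"] i by (simp add: o_def)
    have "\<exists>x. ordered_root (r n) i < x \<and> x < ordered_root (r n) k \<and> poly (pderiv (q (r n))) x = 0" for n
    proof -
      have k: "k < degree (q (r n))" using r(2)[of n] by (simp add: N_def)
      have lt: "ordered_root (r n) i < ordered_root (r n) k" using root_mono[OF i(1) k] .
      obtain x where "ordered_root (r n) i < x" "x < ordered_root (r n) k"
        "poly (q (r n)) (ordered_root (r n) k) - poly (q (r n)) (ordered_root (r n) i)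
           = (ordered_root (r n) k - ordered_root (r n) i) * poly (pderiv (q (r n))) x"
        using poly_MVT[OF lt, of "q (r n)"] by blast
      moreover have "poly (q (r n)) (ordered_root (r n) k) = 0" "poly (q (r n)) (ordered_root (r n) i) = 0"
        using k i by (auto intro: poly_root)
      ultimately show ?thesis using lt by auto
    qed
    then obtain x where x: "\<And>n. ordered_root (r n) i < x n" "\<And>n. x n < ordered_root (r n) k"
        "\<And>n. poly (pderiv (q (r n))) (x n) = 0" by metis
    have "x \<longlonglongrightarrow> l"
      using lim_i lim by (rule tendsto_sandwich[rotated 2]) (auto intro!: always_eventually less_imp_le x)
    then have "(\<lambda>n. poly (pderiv (q (r n))) (x n)) \<longlonglongrightarrow> F' l"
      by (rule continuously_convergentD[OF conv(2) r(1)])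
    then have "F' l = 0" by (simp add: x LIMSEQ_const_iff)
    with simple \<open>F l = 0\<close> show False by blast
  qed
  with upper[of 1] show ?case by (auto elim: eventually_mono)
qed

lemma B_pos: "B > 0"
proof -
  obtain n where n: "0 < degree (q n)"
    using root_tendsto[of 0] eventually_happens'[OF sequentially_bot] by blast
  then have "0 < B * ordered_root n 0" using root_ge[OF n] by simp
  then show ?thesis using root_pos[OF n] by (simp add: zero_less_mult_iff)
qed

text \<open>
  For each \<open>q n\<close> the sum over the roots is an expression in \<open>q n\<close> and its first two derivatives. Since
  the \<open>k\<close>-th root is at least \<open>(k + 1) / B\<close>, the terms are dominated by a multiple of \<open>1 / (k + 1)\<^sup>2\<close>
  for all large \<open>k\<close>, uniformly in \<open>n\<close>, and Tannery's theorem allows the passage to the limit.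
\<close>

theorem sums_inverse_squares:
  assumes z: "F z \<noteq> 0"
  shows "(\<lambda>k. 1 / (w k - z)\<^sup>2) sums (((F' z)\<^sup>2 - F z * F'' z) / (F z)\<^sup>2)"
proof -
  define a where "a k n = (if k < degree (q n) then 1 / (ordered_root n k - z)\<^sup>2 else 0)" for k n
  define M where "M k = 4 * B\<^sup>2 * (1 / (real (Suc k))\<^sup>2)" for k
  have lim: "(\<lambda>n. a k n) \<longlonglongrightarrow> 1 / (w k - z)\<^sup>2" for k
  proof -
    have "w k \<noteq> z" using z w_zero by auto
    then have "(\<lambda>n. 1 / (ordered_root n k - z)\<^sup>2) \<longlonglongrightarrow> 1 / (w k - z)\<^sup>2"
      using root_tendsto[of k] by (intro tendsto_intros) auto
    moreover have "eventually (\<lambda>n. 1 / (ordered_root n k - z)\<^sup>2 = a k n) sequentially"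
      using root_tendsto[of k] by (auto elim!: eventually_mono simp: a_def)
    ultimately show ?thesis by (rule Lim_transform_eventually)
  qed
  have bound: "norm (a k n) \<le> M k" if k: "real (Suc k) \<ge> 2 * B * z" for k n
  proof (cases "k < degree (q n)")
    case True
    have halve: "s / 2 \<le> v - u" if "2 * u \<le> s" "s \<le> v" for s u v :: real
      using that by linarith
    have "real (Suc k) / 2 \<le> B * (ordered_root n k - z)"
      unfolding right_diff_distrib using k root_ge[OF True] by (intro halve) (simp_all add: mult.assoc)
    then have ge: "real (Suc k) / (2 * B) \<le> ordered_root n k - z"
      using B_pos by (simp add: field_simps)
    moreover have "0 < real (Suc k) / (2 * B)" using B_pos by simp
    ultimately have "1 / (ordered_root n k - z)\<^sup>2 \<le> 1 / (real (Suc k) / (2 * B))\<^sup>2"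
      by (intro divide_left_mono power_mono mult_pos_pos zero_less_power) auto
    also have "\<dots> = M k" by (simp add: M_def power_divide power_mult_distrib)
    finally show ?thesis using True by (simp add: a_def)
  qed (simp add: a_def M_def)
  have "eventually (\<lambda>(k, n). norm (a k n) \<le> M k) (at_top \<times>\<^sub>F sequentially)"
  proof -
    obtain K :: nat where K: "real K \<ge> 2 * B * z" using real_arch_simple by blast
    have "eventually (\<lambda>k. k \<ge> K) (at_top :: nat filter)" by (rule eventually_ge_at_top)
    then have "eventually (\<lambda>kn. fst kn \<ge> K) (at_top \<times>\<^sub>F (sequentially :: nat filter))"
      by (rule eventually_compose_filterlim) (rule filterlim_fst)
    then show ?thesis
    proof (rule eventually_mono, clarify)
      fix k n :: nat assume "K \<le> fst (k, n)"
      then show "norm (a k n) \<le> M k" using K by (intro bound) simp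
    qed
  qed
  moreover have "summable M"
    unfolding M_def
    by (intro summable_mult) (use inverse_squares_sums in \<open>auto simp: sums_iff add_ac\<close>)
  ultimately have "eventually (\<lambda>n. summable (\<lambda>k. norm (a k n))) sequentially \<and>
      summable (\<lambda>k. norm (1 / (w k - z)\<^sup>2)) \<and>
      (\<lambda>n. \<Sum>k. a k n) \<longlonglongrightarrow> (\<Sum>k. 1 / (w k - z)\<^sup>2)"
    by (intro tannerys_theorem[where a = a and M = M, OF lim] sequentially_bot)
  then have tannery: "summable (\<lambda>k. norm (1 / (w k - z)\<^sup>2))"
      "(\<lambda>n. \<Sum>k. a k n) \<longlonglongrightarrow> (\<Sum>k. 1 / (w k - z)\<^sup>2)"
    by blast+
  define h where "h n = ((poly (pderiv (q n)) z)\<^sup>2 - poly (q n) z * poly (pderiv (pderiv (q n))) z) / (poly (q n) z)\<^sup>2"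
    for n
  have "h \<longlonglongrightarrow> ((F' z)\<^sup>2 - F z * F'' z) / (F z)\<^sup>2"
    unfolding h_def using z by (intro tendsto_intros continuously_convergent_pointwise conv) auto
  moreover have "eventually (\<lambda>n. h n = (\<Sum>k. a k n)) sequentially"
  proof -
    have "eventually (\<lambda>n. poly (q n) z \<noteq> 0) sequentially"
      using continuously_convergent_pointwise[OF conv(1)] z by (rule tendsto_imp_eventually_ne)
    then show ?thesis
    proof eventually_elim
      case (elim n)
      have "h n = (\<Sum>x | poly (q n) x = 0. 1 / (x - z)\<^sup>2)"
        using real_rooted_log_derivatives[OF finite_roots q_neq_0 card_roots[symmetric], of n z, THEN conjunct2] elim
        by (simp add: h_def)
      also have "\<dots> = (\<Sum>k<degree (q n). 1 / (ordered_root n k - z)\<^sup>2)"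
        by (rule sum.reindex_bij_betw[OF bij_betw_root, symmetric])
      also have "\<dots> = (\<Sum>k<degree (q n). a k n)"
        by (intro sum.cong) (auto simp: a_def)
      also have "\<dots> = (\<Sum>k. a k n)"
        by (rule suminf_finite[symmetric]) (auto simp: a_def)
      finally show ?case .
    qed
  qed
  ultimately have "(\<lambda>n. \<Sum>k. a k n) \<longlonglongrightarrow> ((F' z)\<^sup>2 - F z * F'' z) / (F z)\<^sup>2"
    by (rule Lim_transform_eventually)
  with tannery(2) have "(\<Sum>k. 1 / (w k - z)\<^sup>2) = ((F' z)\<^sup>2 - F z * F'' z) / (F z)\<^sup>2"
    by (rule LIMSEQ_unique)
  with tannery(1) show ?thesis by (simp add: sums_iff summable_norm_cancel)
qed

end

section \<open>Approximation by Laguerre polynomials\<close>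

lemma poly_sums_coeff: "(\<lambda>m. coeff p m * x ^ m) sums poly p x" for p :: "real poly"
  unfolding poly_altdef by (rule sums_finite) (auto simp: coeff_eq_0)

lemma dominated_coeffs_convergent:
  fixes q :: "nat \<Rightarrow> real poly"
  assumes lim: "\<And>m. (\<lambda>n. coeff (q n) m) \<longlonglongrightarrow> c m"
    and bound: "\<And>n m. \<bar>coeff (q n) m\<bar> \<le> C m"
    and summ: "\<And>R. summable (\<lambda>m. C m * R ^ m)"
  shows "continuously_convergent (\<lambda>n. poly (q n)) (\<lambda>x. \<Sum>m. c m * x ^ m)"
  unfolding continuously_convergent_def
proof (intro allI impI)
  fix s :: "nat \<Rightarrow> nat" and X :: "nat \<Rightarrow> real" and x :: real
  assume s: "strict_mono s" and X: "X \<longlonglongrightarrow> x"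
  have "(\<lambda>j. \<Sum>m. coeff (q (s j)) m * X j ^ m) \<longlonglongrightarrow> (\<Sum>m. c m * x ^ m)"
    using LIMSEQ_subseq_LIMSEQ[OF lim s]
    by (intro dominated_powser_tendsto[OF _ bound summ X]) (simp add: o_def)
  then show "(\<lambda>j. poly (q (s j)) (X j)) \<longlonglongrightarrow> (\<Sum>m. c m * x ^ m)"
    by (simp add: sums_unique[OF poly_sums_coeff])
qed

lemma dominated_coeffs_convergent_pderiv:
  fixes q :: "nat \<Rightarrow> real poly"
  assumes lim: "\<And>m. (\<lambda>n. coeff (q n) m) \<longlonglongrightarrow> c m"
    and bound: "\<And>n m. \<bar>coeff (q n) m\<bar> \<le> C m"
    and summ: "\<And>R. summable (\<lambda>m. C m * R ^ m)"
  shows "(\<lambda>n. coeff (pderiv (q n)) m) \<longlonglongrightarrow> diffs c m"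
    and "\<bar>coeff (pderiv (q n)) m\<bar> \<le> diffs C m"
    and "summable (\<lambda>m. diffs C m * R ^ m)"
proof -
  show "(\<lambda>n. coeff (pderiv (q n)) m) \<longlonglongrightarrow> diffs c m"
    unfolding coeff_pderiv diffs_def by (intro tendsto_intros lim)
  show "\<bar>coeff (pderiv (q n)) m\<bar> \<le> diffs C m"
    unfolding coeff_pderiv diffs_def abs_mult by (intro mult_mono bound) auto
  show "summable (\<lambda>m. diffs C m * R ^ m)"
    by (intro termdiff_converges_all summ)
qed

lemma choose_div_power:
  assumes "N > 0"
  shows "real (N choose m) / real N ^ m = (\<Prod>i<m. 1 - real i / real N) / fact m"
proof -
  have "real (N choose m) = (\<Prod>i<m. real N - real i) / fact m"
    by (simp add: binomial_gbinomial gbinomial_prod_rev atLeast0LessThan)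
  also have "(\<Prod>i<m. real N - real i) = (\<Prod>i<m. real N * (1 - real i / real N))"
    using assms by (intro prod.cong) (auto simp: field_simps)
  also have "\<dots> = real N ^ m * (\<Prod>i<m. 1 - real i / real N)"
    by (simp add: prod.distrib)
  finally show ?thesis using assms by simp
qed

lemma choose_div_power_le:
  assumes "N > 0"
  shows "real (N choose m) / real N ^ m \<le> 1 / fact m"
proof (cases "m \<le> N")
  case True
  then have "(\<Prod>i<m. 1 - real i / real N) \<le> 1"
    using assms by (intro prod_le_1) auto
  then show ?thesis using assms by (simp add: choose_div_power divide_right_mono)
qed (simp add: binomial_eq_0)

lemma choose_div_power_tendsto:
  "(\<lambda>n. real (Suc n choose m) / real (Suc n) ^ m) \<longlonglongrightarrow> 1 / fact m"
proof -
  have "(\<lambda>n. 1 - real i / real (Suc n)) \<longlonglongrightarrow> 1" for i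
    by real_asymp
  then have "(\<lambda>n. (\<Prod>i<m. 1 - real i / real (Suc n)) / fact m) \<longlonglongrightarrow> (\<Prod>i<m. 1) / fact m"
    by (intro tendsto_intros) auto
  then show ?thesis by (simp add: choose_div_power del: of_nat_Suc)
qed

text \<open>
  Dividing the argument by the degree turns the coefficient \<open>n choose m\<close> into one that tends to
  \<open>1 / m!\<close> from below, so these polynomials approximate \<open>clifford a\<close>. The index is shifted to avoid
  degree \<open>0\<close>.
\<close>

definition scaled_laguerre :: "real \<Rightarrow> nat \<Rightarrow> real poly" where
  "scaled_laguerre a n = pcompose (laguerre a (Suc n)) [:0, 1 / real (Suc n):]"

lemma coeff_scaled_laguerre:
  "coeff (scaled_laguerre a n) m =
     real (Suc n choose m) / real (Suc n) ^ m * ((-1) ^ m / pochhammer a m)"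
  unfolding scaled_laguerre_def coeff_pcompose_linear coeff_laguerre by (simp add: power_one_over)

lemma scaled_laguerre_root_iff:
  "poly (scaled_laguerre a n) x = 0 \<longleftrightarrow> poly (laguerre a (Suc n)) (x / real (Suc n)) = 0"
  by (simp add: scaled_laguerre_def poly_pcompose)

lemma degree_scaled_laguerre: "a > 0 \<Longrightarrow> degree (scaled_laguerre a n) = Suc n"
  by (simp add: scaled_laguerre_def degree_pcompose degree_laguerre)

lemma card_scaled_laguerre_roots:
  assumes "a > 0"
  shows "card {x. poly (scaled_laguerre a n) x = 0} = Suc n"
proof -
  have "bij_betw (\<lambda>x. real (Suc n) * x) {x. poly (laguerre a (Suc n)) x = 0}
          {x. poly (scaled_laguerre a n) x = 0}"
    by (rule bij_betwI[where g = "\<lambda>x. x / real (Suc n)"]) (auto simp: scaled_laguerre_root_iff)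
  then show ?thesis using laguerre_roots(1)[OF assms, of "Suc n"] bij_betw_same_card by metis
qed

lemma scaled_laguerre_root_pos:
  assumes "a > 0" "poly (scaled_laguerre a n) x = 0"
  shows "x > 0"
  using laguerre_roots(2)[OF assms(1), of "Suc n" "x / real (Suc n)"] assms(2)
  by (simp add: scaled_laguerre_root_iff zero_less_divide_iff)

lemma scaled_laguerre_neq_0: "a > 0 \<Longrightarrow> scaled_laguerre a n \<noteq> 0"
  using degree_scaled_laguerre[of a n] by auto

text \<open>
  The sum of the reciprocal roots is minus the ratio of the two lowest coefficients; it does not
  depend on \<open>n\<close>.
\<close>

lemma scaled_laguerre_reciprocal_sum:
  assumes "a > 0"
  shows "(\<Sum>x | poly (scaled_laguerre a n) x = 0. 1 / x) = 1 / a"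
proof -
  let ?p = "scaled_laguerre a n"
  have "poly (pderiv ?p) 0 = - poly ?p 0 * (\<Sum>x | poly ?p x = 0. 1 / (x - 0))"
    using assms scaled_laguerre_root_pos[OF assms, of n 0]
    by (intro real_rooted_log_derivatives[THEN conjunct1] poly_roots_finite scaled_laguerre_neq_0)
       (auto simp: degree_scaled_laguerre card_scaled_laguerre_roots)
  moreover have "poly ?p 0 = 1" "poly (pderiv ?p) 0 = - 1 / a"
    unfolding poly_0_coeff_0 coeff_pderiv coeff_scaled_laguerre by simp_all
  ultimately show ?thesis by simp
qed

lemma scaled_laguerre_convergent:
  assumes "a > 0"
  shows "continuously_convergent (\<lambda>n. poly (scaled_laguerre a n)) (clifford a)"
    "continuously_convergent (\<lambda>n. poly (pderiv (scaled_laguerre a n))) (\<lambda>w. - clifford (a + 1) w / a)"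
    "continuously_convergent (\<lambda>n. poly (pderiv (pderiv (scaled_laguerre a n))))
       (\<lambda>w. clifford (a + 2) w / (a * (a + 1)))"
proof -
  define C where "C m = \<bar>clifford_coeff a m\<bar>" for m
  have lim: "(\<lambda>n. coeff (scaled_laguerre a n) m) \<longlonglongrightarrow> clifford_coeff a m" for m
    unfolding coeff_scaled_laguerre
    using tendsto_mult_right[OF choose_div_power_tendsto[of m], of "(-1) ^ m / pochhammer a m"]
    by (simp add: clifford_coeff_def)
  have bound: "\<bar>coeff (scaled_laguerre a n) m\<bar> \<le> C m" for n m
  proof -
    have "real (Suc n choose m) / real (Suc n) ^ m * (1 / pochhammer a m) \<le> 1 / fact m * (1 / pochhammer a m)"
      using assms by (intro mult_right_mono choose_div_power_le) (auto intro: pochhammer_nonneg)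
    then show ?thesis
      using assms pochhammer_pos[OF assms, of m]
      by (simp add: C_def abs_clifford_coeff coeff_scaled_laguerre abs_mult power_abs del: of_nat_Suc binomial_Suc_Suc)
  qed
  have summ: "summable (\<lambda>m. C m * R ^ m)" for R
    unfolding C_def using assms by (rule summable_abs_clifford_coeff)
  note D = dominated_coeffs_convergent_pderiv[of "scaled_laguerre a", OF lim bound summ]
  note DD = dominated_coeffs_convergent_pderiv[of "\<lambda>n. pderiv (scaled_laguerre a n)", OF D]
  show "continuously_convergent (\<lambda>n. poly (scaled_laguerre a n)) (clifford a)"
    using dominated_coeffs_convergent[of "scaled_laguerre a", OF lim bound summ] by (simp add: clifford_def[abs_def])
  show "continuously_convergent (\<lambda>n. poly (pderiv (scaled_laguerre a n))) (\<lambda>w. - clifford (a + 1) w / a)"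
    using dominated_coeffs_convergent[of "\<lambda>n. pderiv (scaled_laguerre a n)", OF D]
    unfolding sums_unique[OF clifford_deriv_series[OF assms], symmetric] .
  show "continuously_convergent (\<lambda>n. poly (pderiv (pderiv (scaled_laguerre a n))))
       (\<lambda>w. clifford (a + 2) w / (a * (a + 1)))"
    using dominated_coeffs_convergent[of "\<lambda>n. pderiv (pderiv (scaled_laguerre a n))", OF DD]
    unfolding sums_unique[OF clifford_deriv2_series[OF assms], symmetric] .
qed

section \<open>Enumeration of the positive Bessel zeros\<close>

text \<open>
  If \<open>y = clifford a\<close> had no zero beyond \<open>u\<close>, then \<open>f = - w y' / y\<close> would satisfy the Riccati equation
  \<open>f' = 1 + (f\<^sup>2 - (a - 1) f) / w\<close> for all \<open>w > max u 0\<close>. There \<open>f\<close> first grows at least linearly, because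
  the right-hand side is eventually at least \<open>1 / 2\<close>; once \<open>f\<close> is large, \<open>f' \<ge> f\<^sup>2 / (2 w)\<close>, so that
  \<open>- 1 / f\<close> grows at least like \<open>(ln w) / 2\<close>, although it is negative.
\<close>

lemma clifford_oscillates:
  assumes a: "a > 0"
  shows "\<exists>y>u. clifford a y = 0"
proof (rule ccontr)
  assume "\<not> (\<exists>y>u. clifford a y = 0)"
  then have nz: "clifford a y \<noteq> 0" if "y > u" for y using that by blast
  define b where "b = a - 1"
  define f where "f w = w * clifford (a + 1) w / (a * clifford a w)" for w
  define T where "T = max (u + 1) (b\<^sup>2 / 2 + 1)"
  have "T \<ge> u + 1" "T \<ge> b\<^sup>2 / 2 + 1" by (simp_all add: T_def)
  then have T: "T > u" "T > 0" "T \<ge> b\<^sup>2 / 2"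
    using zero_le_power2[of b] by linarith+
  have f: "(f has_real_derivative 1 + ((f w)\<^sup>2 - b * f w) / w) (at w)" if "w > u" "w > 0" for w
  proof -
    define g g1 g2 where "g = clifford a w" "g1 = clifford (a + 1) w" "g2 = clifford (a + 2) w"
    have "g \<noteq> 0" using nz that by (simp add: g_g1_g2_def)
    have rec: "w * g2 = a * (a + 1) * (g1 - g)"
    proof -
      have "g1 - g = w * g2 / (a * (a + 1))"
        using clifford_recurrence[OF a, of w] by (simp add: g_g1_g2_def)
      then show ?thesis using a by (simp add: eq_divide_eq mult_ac)
    qed
    have "(f has_real_derivative
        ((g1 + w * (- g2 / (a + 1))) * (a * g) - w * g1 * (a * (- g1 / a))) / (a * g)\<^sup>2) (at w)"
      unfolding f_def g_g1_g2_def using a nz[OF that(1)]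
      by (auto intro!: derivative_eq_intros DERIV_clifford simp: power2_eq_square add.assoc)
    also have "((g1 + w * (- g2 / (a + 1))) * (a * g) - w * g1 * (a * (- g1 / a))) / (a * g)\<^sup>2
        = 1 + ((f w)\<^sup>2 - b * f w) / w"
    proof -
      have e: "w * (- g2 / (a + 1)) = - a * (g1 - g)"
        using rec a by (simp add: field_simps)
      have fw: "f w = w * g1 / (a * g)" by (simp add: f_def g_g1_g2_def)
      show ?thesis
        unfolding e fw b_def using a \<open>g \<noteq> 0\<close> that
        by (simp add: divide_simps power2_eq_square) (simp add: algebra_simps)
    qed
    finally show ?thesis .
  qed
  have grow: "f T + (w - T) / 2 \<le> f w" if "w \<ge> T" for w
  proof -
    have "(\<lambda>w. f w - w / 2) T \<le> (\<lambda>w. f w - w / 2) w"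
    proof (rule DERIV_nonneg_imp_nondecreasing[OF that])
      fix x assume x: "T \<le> x" "x \<le> w"
      have "(f x)\<^sup>2 - b * f x \<ge> - (b\<^sup>2 / 4)"
        using zero_le_power2[of "f x - b / 2"] by (simp add: power2_eq_square algebra_simps)
      also have "- (b\<^sup>2 / 4) \<ge> - x / 2" using T x by simp
      finally have "((f x)\<^sup>2 - b * f x) / x \<ge> - 1 / 2" using x T by (simp add: field_simps)
      moreover have "((\<lambda>w. f w - w / 2) has_real_derivative 1 + ((f x)\<^sup>2 - b * f x) / x - 1 / 2) (at x)"
        using x T by (auto intro!: derivative_eq_intros f)
      ultimately show "\<exists>y. ((\<lambda>w. f w - w / 2) has_real_derivative y) (at x) \<and> 0 \<le> y"
        by (intro exI conjI) auto
    qed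
    then show ?thesis by (simp add: field_simps)
  qed
  define W where "W = T + 2 * (2 * \<bar>b\<bar> + 1 + \<bar>f T\<bar>)"
  have W: "W \<ge> T" by (simp add: W_def)
  have large: "f w \<ge> 2 * \<bar>b\<bar> + 1" if "w \<ge> W" for w
  proof -
    have "w \<ge> T" using that W by linarith
    from grow[OF this] show ?thesis
      using that abs_ge_minus_self[of "f T"] unfolding W_def by (simp add: field_simps)
  qed
  \<comment> \<open>Here the lower bound for \<open>- 1 / f\<close>, which starts from \<open>- 1 / f W\<close> at \<open>W\<close>, has become positive.\<close>
  define w where "w = W * exp (2 / f W + 1)"
  have "f W > 0" using large[of W] by simp
  then have wW: "w \<ge> W" using W T by (simp add: w_def)
  have "(\<lambda>w. - 1 / f w - ln w / 2) W \<le> (\<lambda>w. - 1 / f w - ln w / 2) w"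
  proof (rule DERIV_nonneg_imp_nondecreasing[OF wW])
    fix x assume x: "W \<le> x" "x \<le> w"
    define f' where "f' = 1 + ((f x)\<^sup>2 - b * f x) / x"
    have x0: "x > 0" "x > u" using x W T by auto
    have fx: "f x \<ge> 2 * \<bar>b\<bar> + 1" using large x by blast
    then have f0: "f x > 0" by linarith
    have "b * f x \<le> (f x / 2) * f x"
      using fx f0 by (intro mult_right_mono) auto
    then have "(f x)\<^sup>2 - b * f x \<ge> (f x)\<^sup>2 / 2" by (simp add: power2_eq_square)
    then have "((f x)\<^sup>2 - b * f x) / x \<ge> (f x)\<^sup>2 / 2 / x"
      using x0 by (intro divide_right_mono) auto
    then have "f' \<ge> (f x)\<^sup>2 / (2 * x)" by (simp add: f'_def)
    then have "f' / (f x)\<^sup>2 - 1 / (2 * x) \<ge> 0"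
      using f0 x0 by (simp add: field_simps)
    moreover have "((\<lambda>w. - 1 / f w - ln w / 2) has_real_derivative f' / (f x)\<^sup>2 - 1 / (2 * x)) (at x)"
      using x0 f0 f[OF x0(2,1)] unfolding f'_def[symmetric]
      by (auto intro!: derivative_eq_intros simp: power2_eq_square field_simps)
    ultimately show "\<exists>y. ((\<lambda>w. - 1 / f w - ln w / 2) has_real_derivative y) (at x) \<and> 0 \<le> y"
      by blast
  qed
  moreover have "ln w = ln W + (2 / f W + 1)" using W T by (simp add: w_def ln_mult)
  moreover have "1 / f w > 0" using large[OF wW] by simp
  ultimately show False by (simp add: field_simps)
qed

text \<open>
  This is what makes least zeros exist: beyond any point the zeros form a closed set.
\<close>

lemma clifford_zeros_isolated_right:
  assumes a: "a > 0"
  shows "\<exists>\<delta>>0. \<forall>y. u < y \<and> y < u + \<delta> \<longrightarrow> clifford a y \<noteq> 0"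
proof (cases "clifford a u = 0")
  case True
  define d where "d = - clifford (a + 1) u / a"
  have der: "(clifford a has_real_derivative d) (at u)" unfolding d_def by (rule DERIV_clifford[OF a])
  have "d \<noteq> 0" using clifford_zero_simple[OF a True] a by (simp add: d_def)
  then have "d > 0 \<or> d < 0" by linarith
  then obtain \<delta> where \<delta>: "\<delta> > 0" "\<forall>h>0. h < \<delta> \<longrightarrow> clifford a (u + h) \<noteq> 0"
    using DERIV_pos_inc_right[OF der] DERIV_neg_dec_right[OF der] True by (metis less_irrefl)
  show ?thesis
  proof (intro exI conjI allI impI)
    fix y assume "u < y \<and> y < u + \<delta>"
    then show "clifford a y \<noteq> 0" using \<delta>(2)[rule_format, of "y - u"] by simp
  qed (use \<delta> in auto)
next
  case False
  have "isCont (clifford a) u" by (rule DERIV_isCont[OF DERIV_clifford[OF a]])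
  then have "eventually (\<lambda>y. clifford a y \<noteq> 0) (at u)"
    unfolding isCont_def using False by (rule tendsto_imp_eventually_ne)
  then obtain \<delta> where \<delta>: "\<delta> > 0" "\<forall>y. y \<noteq> u \<and> dist y u < \<delta> \<longrightarrow> clifford a y \<noteq> 0"
    by (auto simp: eventually_at)
  then show ?thesis
    by (intro exI[of _ \<delta>]) (auto simp: dist_real_def)
qed

lemma clifford_next_zero:
  assumes a: "a > 0"
  shows "\<exists>z>u. clifford a z = 0 \<and> (\<forall>y>u. clifford a y = 0 \<longrightarrow> z \<le> y)"
proof -
  obtain \<delta> where \<delta>: "\<delta> > 0" "\<And>y. u < y \<Longrightarrow> y < u + \<delta> \<Longrightarrow> clifford a y \<noteq> 0"
    using clifford_zeros_isolated_right[OF a, of u] by blast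
  define Z where "Z = {u + \<delta>..} \<inter> {y. clifford a y = 0}"
  have Z_iff: "y \<in> Z \<longleftrightarrow> y > u \<and> clifford a y = 0" for y
    using \<delta>(1) \<delta>(2)[of y] by (auto simp: Z_def not_less[symmetric])
  have "continuous_on UNIV (clifford a)"
    by (intro continuous_at_imp_continuous_on ballI DERIV_isCont[OF DERIV_clifford[OF a]])
  then have "closed Z" unfolding Z_def
    by (intro closed_Int closed_atLeast closed_Collect_eq continuous_on_const)
  moreover have "Z \<noteq> {}" using clifford_oscillates[OF a, of u] Z_iff by blast
  moreover have "bdd_below Z" by (rule bdd_belowI[of _ u]) (auto simp: Z_iff)
  ultimately have "Inf Z \<in> Z" "\<forall>y\<in>Z. Inf Z \<le> y"
    by (auto intro: closed_contains_Inf cInf_lower)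
  then show ?thesis by (intro exI[of _ "Inf Z"]) (auto simp: Z_iff)
qed

lemma bessel_J_eq_clifford:
  assumes "\<mu> > -1" "x > 0"
  shows "bessel_J \<mu> x = (x / 2) powr \<mu> / Gamma (\<mu> + 1) * clifford (\<mu> + 1) (x\<^sup>2 / 4)"
proof -
  have G: "Gamma (\<mu> + 1) > 0" using assms by (intro Gamma_real_pos) simp
  have "(-1) ^ m / (fact m * Gamma (real m + \<mu> + 1)) * (x / 2) powr (2 * real m + \<mu>)
      = (x / 2) powr \<mu> / Gamma (\<mu> + 1) * (clifford_coeff (\<mu> + 1) m * (x\<^sup>2 / 4) ^ m)" for m
  proof -
    have "\<mu> + 1 \<notin> \<int>\<^sub>\<le>\<^sub>0" using assms by (auto dest: nonpos_Ints_nonpos)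
    then have "Gamma (real m + \<mu> + 1) = pochhammer (\<mu> + 1) m * Gamma (\<mu> + 1)"
      using pochhammer_Gamma[of "\<mu> + 1" m] G by (simp add: add_ac)
    moreover have "(x / 2) powr (2 * real m + \<mu>) = (x\<^sup>2 / 4) ^ m * (x / 2) powr \<mu>"
    proof -
      have "(x / 2) powr (2 * real m) = (x / 2) ^ (2 * m)"
        using assms by (subst powr_realpow[symmetric]) auto
      also have "\<dots> = (x\<^sup>2 / 4) ^ m" by (simp add: power_mult power_divide)
      finally show ?thesis by (simp add: powr_add)
    qed
    ultimately show ?thesis by (simp add: clifford_coeff_def mult_ac)
  qed
  then have "bessel_J \<mu> x = (\<Sum>m. (x / 2) powr \<mu> / Gamma (\<mu> + 1) * (clifford_coeff (\<mu> + 1) m * (x\<^sup>2 / 4) ^ m))"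
    by (simp add: bessel_J_def)
  also have "\<dots> = (x / 2) powr \<mu> / Gamma (\<mu> + 1) * clifford (\<mu> + 1) (x\<^sup>2 / 4)"
    unfolding clifford_def using assms by (intro suminf_mult summable_clifford_coeff) simp
  finally show ?thesis .
qed

lemma bessel_J_eq_0_iff:
  assumes "\<mu> > -1" "x > 0"
  shows "bessel_J \<mu> x = 0 \<longleftrightarrow> clifford (\<mu> + 1) (x\<^sup>2 / 4) = 0"
proof -
  have "Gamma (\<mu> + 1) \<noteq> 0" using assms by (intro Gamma_real_pos[THEN less_imp_neq, THEN not_sym]) simp
  then show ?thesis using assms by (simp add: bessel_J_eq_clifford)
qed

lemma bessel_next_zero:
  assumes \<mu>: "\<mu> > -1" and t: "t \<ge> 0"
  shows "\<exists>x>t. bessel_J \<mu> x = 0 \<and> (\<forall>y>t. bessel_J \<mu> y = 0 \<longrightarrow> x \<le> y)"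
proof -
  obtain z where z: "z > t\<^sup>2 / 4" "clifford (\<mu> + 1) z = 0"
      "\<And>y. y > t\<^sup>2 / 4 \<Longrightarrow> clifford (\<mu> + 1) y = 0 \<Longrightarrow> z \<le> y"
    using clifford_next_zero[of "\<mu> + 1" "t\<^sup>2 / 4"] \<mu> by auto
  have "z > 0" using z(1) by (smt (verit) zero_le_power2 divide_nonneg_nonneg)
  define x where "x = 2 * sqrt z"
  have x: "x\<^sup>2 / 4 = z" "x > 0" using \<open>z > 0\<close> by (auto simp: x_def power_mult_distrib)
  have "x > t"
    using z(1) x by (intro power_less_imp_less_base[of t 2 x]) auto
  moreover have "bessel_J \<mu> x = 0" using \<mu> x z by (simp add: bessel_J_eq_0_iff)
  moreover have "x \<le> y" if y: "y > t" "bessel_J \<mu> y = 0" for y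
  proof -
    have "y > 0" using y t by linarith
    then have "clifford (\<mu> + 1) (y\<^sup>2 / 4) = 0" using y \<mu> by (simp add: bessel_J_eq_0_iff)
    moreover have "t\<^sup>2 < y\<^sup>2" using y t by (intro power_strict_mono) auto
    ultimately have "z \<le> y\<^sup>2 / 4" by (intro z(3)) auto
    then show ?thesis using x \<open>y > 0\<close> by (intro power_le_imp_le_base[of x 1 y, unfolded Suc_1]) (auto simp: numeral_2_eq_2)
  qed
  ultimately show ?thesis by blast
qed

text \<open>
  These four facts replace the definition of the zeros by a least element, which by itself would be
  meaningless if no least zero existed.
\<close>

lemma bessel_zero_Suc:
  assumes \<mu>: "\<mu> > -1"
  shows bessel_zero_nonneg: "bessel_zero \<mu> n \<ge> 0"
    and bessel_zero_less_Suc: "bessel_zero \<mu> n < bessel_zero \<mu> (Suc n)"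
    and bessel_J_bessel_zero: "bessel_J \<mu> (bessel_zero \<mu> (Suc n)) = 0"
    and bessel_zero_Suc_le: "bessel_zero \<mu> n < y \<Longrightarrow> bessel_J \<mu> y = 0 \<Longrightarrow> bessel_zero \<mu> (Suc n) \<le> y"
proof -
  have step: "bessel_zero \<mu> n < bessel_zero \<mu> (Suc n) \<and> bessel_J \<mu> (bessel_zero \<mu> (Suc n)) = 0 \<and>
         (\<forall>y>bessel_zero \<mu> n. bessel_J \<mu> y = 0 \<longrightarrow> bessel_zero \<mu> (Suc n) \<le> y)"
    if nonneg: "bessel_zero \<mu> n \<ge> 0" for n
  proof -
    obtain x where x: "x > bessel_zero \<mu> n" "bessel_J \<mu> x = 0"
        "\<forall>y>bessel_zero \<mu> n. bessel_J \<mu> y = 0 \<longrightarrow> x \<le> y"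
      using bessel_next_zero[OF \<mu> nonneg] by blast
    have "bessel_zero \<mu> (Suc n) = x"
      unfolding bessel_zero.simps by (rule Least_equality) (use x in auto)
    with x show ?thesis by simp
  qed
  show nonneg: "bessel_zero \<mu> n \<ge> 0"
  proof (induction n)
    case (Suc n)
    then show ?case using step[of n] by linarith
  qed simp
  show "bessel_zero \<mu> n < bessel_zero \<mu> (Suc n)" "bessel_J \<mu> (bessel_zero \<mu> (Suc n)) = 0"
      "bessel_zero \<mu> n < y \<Longrightarrow> bessel_J \<mu> y = 0 \<Longrightarrow> bessel_zero \<mu> (Suc n) \<le> y"
    using step[OF nonneg] by blast+
qed

text \<open>
  Up to sign the sum is the derivative of the logarithmic derivative of \<open>clifford a\<close> at \<open>z\<close>, with both
  derivatives expressed by neighbouring functions.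
\<close>

lemma bessel_zero_sums_inverse_squares:
  assumes \<mu>: "\<mu> > -1" and z: "clifford (\<mu> + 1) z \<noteq> 0"
  defines "a \<equiv> \<mu> + 1"
  shows "(\<lambda>k. 1 / ((bessel_zero \<mu> (Suc k))\<^sup>2 / 4 - z)\<^sup>2) sums
           (((- clifford (a + 1) z / a)\<^sup>2 - clifford a z * (clifford (a + 2) z / (a * (a + 1)))) / (clifford a z)\<^sup>2)"
proof -
  have a: "a > 0" using \<mu> by (simp add: a_def)
  define w where "w k = (bessel_zero \<mu> (Suc k))\<^sup>2 / 4" for k
  have pos: "bessel_zero \<mu> (Suc k) > 0" for k
    using bessel_zero_nonneg[OF \<mu>, of k] bessel_zero_less_Suc[OF \<mu>, of k] by linarith
  have w_mono: "strict_mono w"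
    unfolding strict_mono_Suc_iff w_def
    using bessel_zero_less_Suc[OF \<mu>] pos by (auto intro!: divide_strict_right_mono power_strict_mono less_imp_le
      simp del: bessel_zero.simps)
  have w_zero: "clifford a (w k) = 0" for k
    using bessel_J_bessel_zero[OF \<mu>, of k] bessel_J_eq_0_iff[OF \<mu> pos[of k]] by (simp add: w_def a_def)
  have w_all: "\<exists>i<k. y = w i" if y: "clifford a y = 0" "0 \<le> y" "y < w k" for k y
  proof -
    have "y > 0" using y by (cases "y = 0") auto
    define x where "x = 2 * sqrt y"
    have x: "x\<^sup>2 / 4 = y" "x > 0" using \<open>y > 0\<close> by (auto simp: x_def power_mult_distrib)
    have J: "bessel_J \<mu> x = 0" using x y bessel_J_eq_0_iff[OF \<mu> x(2)] by (simp add: a_def)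
    show ?thesis using y(3)
    proof (induction k)
      case (Suc k)
      have "x < bessel_zero \<mu> (Suc (Suc k))"
        using Suc.prems x pos[of "Suc k"]
        by (intro power_less_imp_less_base[of x 2]) (auto simp: w_def less_imp_le)
      then have "x \<le> bessel_zero \<mu> (Suc k)"
        using bessel_zero_Suc_le[OF \<mu> _ J, of "Suc k"] by linarith
      then have "y \<le> w k" using x pos[of k] unfolding x(1)[symmetric] w_def
        by (intro divide_right_mono power_mono) auto
      then show ?case using Suc.IH by (cases "y = w k") (auto intro: less_SucI)
    next
      case 0
      have "x < bessel_zero \<mu> (Suc 0)"
        using 0 x pos[of 0] by (intro power_less_imp_less_base[of x 2]) (auto simp: w_def less_imp_le)
      then show ?case using bessel_zero_Suc_le[OF \<mu> _ J, of 0] x(2) by simp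
    qed
  qed
  interpret real_rooted_limit "scaled_laguerre a" "clifford a" "\<lambda>w. - clifford (a + 1) w / a"
      "\<lambda>w. clifford (a + 2) w / (a * (a + 1))" w "1 / a"
    using a by unfold_locales
      ((rule scaled_laguerre_convergent DERIV_clifford w_all; assumption) |
       auto simp: scaled_laguerre_neq_0 card_scaled_laguerre_roots degree_scaled_laguerre
         scaled_laguerre_reciprocal_sum w_mono w_zero clifford_zero_simple
         dest: scaled_laguerre_root_pos)+
  show ?thesis using sums_inverse_squares[of z] z by (simp add: w_def a_def)
qed

section \<open>Sums over the zeros of order two higher\<close>

theorem mainTheorem11:
  fixes \<nu> :: real and n :: nat
  assumes "\<nu> > -1" and "n \<ge> 1"
  shows "((\<lambda>k. 1 / ((bessel_zero \<nu> n)\<^sup>2 - (bessel_zero (\<nu> + 2) k)\<^sup>2)\<^sup>2) has_sum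
           (1 / (16 * (\<nu> + 1)\<^sup>2) - (\<nu> + 2) / (bessel_zero \<nu> n) ^ 4)) {1..}"
proof -
  define x where "x = bessel_zero \<nu> n"
  define z where "z = x\<^sup>2 / 4"
  define a where "a = \<nu> + 1"
  have a: "a > 0" using assms by (simp add: a_def)
  obtain l where n: "n = Suc l" using assms(2) by (cases n) auto
  have x: "x > 0" "bessel_J \<nu> x = 0"
    using bessel_zero_nonneg[OF assms(1), of l] bessel_zero_less_Suc[OF assms(1), of l]
      bessel_J_bessel_zero[OF assms(1), of l]
    unfolding x_def n by linarith+
  then have z: "z > 0" "clifford a z = 0"
    using bessel_J_eq_0_iff[OF assms(1)] by (auto simp: z_def a_def)
  define g0 g1 g2 g3 g4 where "g0 = clifford a z" "g1 = clifford (a + 1) z" "g2 = clifford (a + 2) z"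
    "g3 = clifford (a + 3) z" "g4 = clifford (a + 4) z"
  note g = g0_g1_g2_g3_g4_def
  have g1: "g1 = z / (a * (a + 1)) * g2"
    using clifford_recurrence[OF a, of z] z by (simp add: g)
  have "g1 \<noteq> 0" using clifford_zero_simple[OF a z(2)] by (simp add: g)
  then have g2: "g2 \<noteq> 0" using g1 by auto
  have r1: "g1 = g2 - z / ((a + 1) * (a + 2)) * g3"
    using clifford_recurrence[of "a + 1" z] a by (simp add: g add.assoc)
  have r2: "g2 = g3 - z / ((a + 2) * (a + 3)) * g4"
    using clifford_recurrence[of "a + 2" z] a by (simp add: g add.assoc)
  \<comment> \<open>Minus the logarithmic derivative of \<open>clifford (a + 2)\<close> at \<open>z\<close>; it is a rational function of \<open>z\<close>
    because \<open>clifford a\<close> vanishes there.\<close>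
  define h where "h = (a + 1) / z - 1 / a"
  have g3: "g3 / (a + 2) = h * g2"
  proof -
    have eq: "z / ((a + 1) * (a + 2)) * g3 = g2 * (1 - z / (a * (a + 1)))"
      using g1 r1 by (simp add: algebra_simps)
    have "g3 / (a + 2) = (a + 1) / z * (z / ((a + 1) * (a + 2)) * g3)"
      using a z(1) by simp
    also have "\<dots> = ((a + 1) / z - (a + 1) / z * (z / (a * (a + 1)))) * g2"
      unfolding eq by (simp add: algebra_simps)
    also have "(a + 1) / z * (z / (a * (a + 1))) = 1 / a"
      using a z(1) by simp
    finally have "g3 / (a + 2) = ((a + 1) / z - 1 / a) * g2" .
    then have "g3 / (a + 2) = h * g2" by (simp only: h_def)
    then show ?thesis .
  qed
  have g4: "g4 / ((a + 2) * (a + 3)) = ((a + 2) * h - 1) * g2 / z"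
    using r2 g3 a z(1) by (simp add: field_simps)
  have "(\<lambda>k. 1 / ((bessel_zero (\<nu> + 2) (Suc k))\<^sup>2 / 4 - z)\<^sup>2) sums
          (((- g3 / (a + 2))\<^sup>2 - g2 * (g4 / ((a + 2) * (a + 3)))) / g2\<^sup>2)"
    using bessel_zero_sums_inverse_squares[of "\<nu> + 2" z] assms g2
    by (simp add: g a_def add_ac)
  also have "((- g3 / (a + 2))\<^sup>2 - g2 * (g4 / ((a + 2) * (a + 3)))) / g2\<^sup>2 = h\<^sup>2 - ((a + 2) * h - 1) / z"
  proof -
    have "(- g3 / (a + 2))\<^sup>2 = h\<^sup>2 * g2\<^sup>2"
      using g3 by (simp add: power_divide[symmetric] power_mult_distrib del: power_divide)
    then show ?thesis unfolding g4 using g2 by (simp add: field_simps power2_eq_square)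
  qed
  also have "\<dots> = 1 / a\<^sup>2 - (a + 1) / z\<^sup>2"
    unfolding h_def using a z(1) by (simp add: field_simps power2_eq_square)
  finally have "(\<lambda>k. 1 / 16 * (1 / ((bessel_zero (\<nu> + 2) (Suc k))\<^sup>2 / 4 - z)\<^sup>2)) sums
      (1 / 16 * (1 / a\<^sup>2 - (a + 1) / z\<^sup>2))"
    by (rule sums_mult)
  moreover have "1 / 16 * (1 / ((bessel_zero (\<nu> + 2) (Suc k))\<^sup>2 / 4 - z)\<^sup>2)
      = 1 / (x\<^sup>2 - (bessel_zero (\<nu> + 2) (Suc k))\<^sup>2)\<^sup>2" for k
  proof -
    have "(x\<^sup>2 - (bessel_zero (\<nu> + 2) (Suc k))\<^sup>2)\<^sup>2 = 16 * ((bessel_zero (\<nu> + 2) (Suc k))\<^sup>2 / 4 - z)\<^sup>2"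
      by (simp add: z_def power2_eq_square algebra_simps)
    then show ?thesis by simp
  qed
  moreover have "1 / 16 * (1 / a\<^sup>2 - (a + 1) / z\<^sup>2) = 1 / (16 * (\<nu> + 1)\<^sup>2) - (\<nu> + 2) / x ^ 4"
  proof -
    have "z\<^sup>2 = x ^ 4 / 16" by (simp add: z_def power_divide)
    then show ?thesis by (simp add: a_def right_diff_distrib add_ac)
  qed
  ultimately have "(\<lambda>k. 1 / (x\<^sup>2 - (bessel_zero (\<nu> + 2) (Suc k))\<^sup>2)\<^sup>2) sums
      (1 / (16 * (\<nu> + 1)\<^sup>2) - (\<nu> + 2) / x ^ 4)"
    by (simp only:)
  then have "((\<lambda>k. 1 / (x\<^sup>2 - (bessel_zero (\<nu> + 2) (Suc k))\<^sup>2)\<^sup>2) has_sum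
      (1 / (16 * (\<nu> + 1)\<^sup>2) - (\<nu> + 2) / x ^ 4)) UNIV"
    by (intro sums_nonneg_imp_has_sum) auto
  then have "((\<lambda>k. 1 / (x\<^sup>2 - (bessel_zero (\<nu> + 2) k)\<^sup>2)\<^sup>2) has_sum
      (1 / (16 * (\<nu> + 1)\<^sup>2) - (\<nu> + 2) / x ^ 4)) {1..}"
  proof (rule has_sum_reindex_bij_betw[THEN iffD1, rotated])
    show "bij_betw Suc UNIV {1..}"
      by (rule bij_betwI[where g = "\<lambda>k. k - 1"]) auto
  qed
  then show ?thesis unfolding x_def .
qed

end
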